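(* Suppose $d\ge 2k$. For every pair partition $\mathfrak{m}$ of $\{1,\dots,2k\}$, $$\mathrm{Wg}^{\mathrm{COE}}(\mathfrak{m},d)=\mathrm{Wg}^{\mathrm{O}}(\mathfrak{m},d+1).$$
   Context: $\mathrm{COE}(d)$ is the set of $d\times d$ symmetric unitary matrices with the unique probability measure $\nu$ invariant under $s\mapsto gsg^{\mathrm{t}}$, $g\in\mathrm{U}(d)$; $s_{ij}$ are matrix entries. $\mathrm{Wg}^{\mathrm{COE}}(\mathfrak{m},d)=\int_{\mathrm{COE}(d)}\prod_{j=1}^k s_{2j-1,2j}\cdot\overline{\prod_{\{a,b\}\in\mathfrak{m}}s_{a,b}}\,d\nu$. For integers $D\ge2k$, $\mathrm{Wg}^{\mathrm{O}}(\mathfrak{m},D)=\int_{\mathrm{O}(D)}u_{i_1j_1}\cdots u_{i_{2k}j_{2k}}\,d\mu(U)$, where $\mu$ is the Haar probability measure on the orthogonal group $\mathrm{O}(D)$, $\mathbf{i}\in\{1,\dots,D\}^{2k}$ satisfies $i_r=i_s\iff\{r,s\}$ is a block of $\{1,2\}\{3,4\}\cdots\{2k-1,2k\}$, and $\mathbf{j}$ satisfies $j_r=j_s\iff\{r,s\}\in\mathfrak{m}$ (for $r\ne s$); this does not depend on the choices. *)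

theory Defs
  imports
    "HOL-Probability.Probability_Measure"
    "HOL-Library.Disjoint_Sets"
    "Jordan_Normal_Form.Schur_Decomposition"
begin

text \<open>
  Matrix entries with the usual indices \<open>1, ..., d\<close>; the underlying matrix type counts from 0.
\<close>
definition entry :: "'a mat \<Rightarrow> nat \<Rightarrow> nat \<Rightarrow> 'a" where
  "entry A i j = A $$ (i - 1, j - 1)"

text \<open>
  The Borel structure of a set \<open>X\<close> of \<open>d \<times> d\<close> matrices, as a subspace of the space of families
  indexed by pairs of positions. Only the space and the sigma-algebra of this measure are meaningful.
\<close>
definition mat_borel :: "nat \<Rightarrow> 'a::topological_space mat set \<Rightarrow> 'a mat measure" where
  "mat_borel d X =
     vimage_algebra X (\<lambda>A. restrict (\<lambda>ij. A $$ ij) ({..<d} \<times> {..<d}))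
       (Pi\<^sub>M ({..<d} \<times> {..<d}) (\<lambda>_. borel))"

definition unitary_group :: "nat \<Rightarrow> complex mat set" where
  "unitary_group d = {g \<in> carrier_mat d d. g * mat_adjoint g = 1\<^sub>m d}"

text \<open>
  The library constant \<open>orthogonal_mat\<close> only requires the columns to be nonzero and pairwise
  orthogonal, so it does not describe the orthogonal group.
\<close>
definition orthogonal_group :: "nat \<Rightarrow> real mat set" where
  "orthogonal_group D = {g \<in> carrier_mat D D. g * g\<^sup>T = 1\<^sub>m D}"

definition COE :: "nat \<Rightarrow> complex mat set" where
  "COE d = {s \<in> unitary_group d. s\<^sup>T = s}"

text \<open>
  The two conditions below characterise one measure each: the invariant probability measure on the
  symmetric unitary matrices, and the Haar probability measure on the orthogonal group (which
  is compact, so that left invariance is enough).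
\<close>
definition is_COE_measure :: "nat \<Rightarrow> complex mat measure \<Rightarrow> bool" where
  "is_COE_measure d \<nu> \<longleftrightarrow>
     prob_space \<nu> \<and> space \<nu> = COE d \<and> sets \<nu> = sets (mat_borel d (COE d)) \<and>
     (\<forall>g\<in>unitary_group d. distr \<nu> \<nu> (\<lambda>s. g * s * g\<^sup>T) = \<nu>)"

definition is_Haar_orthogonal :: "nat \<Rightarrow> real mat measure \<Rightarrow> bool" where
  "is_Haar_orthogonal D \<mu> \<longleftrightarrow>
     prob_space \<mu> \<and> space \<mu> = orthogonal_group D \<and>
     sets \<mu> = sets (mat_borel D (orthogonal_group D)) \<and>
     (\<forall>g\<in>orthogonal_group D. distr \<mu> \<mu> (\<lambda>u. g * u) = \<mu>)"

definition pair_partition :: "nat \<Rightarrow> nat set set \<Rightarrow> bool" where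
  "pair_partition k m \<longleftrightarrow> partition_on {1..2*k} m \<and> (\<forall>B\<in>m. card B = 2)"

definition standard_pairing :: "nat \<Rightarrow> nat set set" where
  "standard_pairing k = (\<lambda>j. {2*j - 1, 2*j}) ` {1..k}"

text \<open>
  A multi-index of length \<open>2*k\<close> with values in \<open>{1..D}\<close> whose coincidences are exactly the
  blocks of the pair partition \<open>p\<close>.
\<close>
definition index_of_type :: "nat \<Rightarrow> nat \<Rightarrow> nat set set \<Rightarrow> (nat \<Rightarrow> nat) \<Rightarrow> bool" where
  "index_of_type k D p f \<longleftrightarrow>
     f \<in> {1..2*k} \<rightarrow> {1..D} \<and>
     (\<forall>r\<in>{1..2*k}. \<forall>s\<in>{1..2*k}. r \<noteq> s \<longrightarrow> (f r = f s \<longleftrightarrow> {r, s} \<in> p))"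

text \<open>
  A block \<open>{a, b}\<close> contributes the entry at \<open>(a, b)\<close> with \<open>a < b\<close>; by symmetry of the matrices the
  order is immaterial.
\<close>
definition Wg_COE :: "complex mat measure \<Rightarrow> nat \<Rightarrow> nat set set \<Rightarrow> complex" where
  "Wg_COE \<nu> k m =
     (\<integral>s. (\<Prod>j=1..k. entry s (2*j - 1) (2*j)) * cnj (\<Prod>B\<in>m. entry s (Min B) (Max B)) \<partial>\<nu>)"

text \<open>
  The orthogonal Weingarten function at \<open>m\<close> is the common value of the following integral over all
  \<open>i\<close> of type \<^term>\<open>standard_pairing k\<close> and all \<open>j\<close> of type \<open>m\<close>.
\<close>
definition Wg_O :: "real mat measure \<Rightarrow> nat \<Rightarrow> (nat \<Rightarrow> nat) \<Rightarrow> (nat \<Rightarrow> nat) \<Rightarrow> real" where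
  "Wg_O \<mu> k i j = (\<integral>u. (\<Prod>r=1..2*k. entry u (i r) (j r)) \<partial>\<mu>)"

end

theory Submission
  imports Defs "HOL-Combinatorics.Transposition"
begin

text \<open>
  Both sides are evaluations of a multilinear form, on vectors indexed by a finite set of positions,
  that is invariant under real plane reflections. If four positions carry the same basis vector,
  invariance under rotations of a plane expresses the coefficient as the sum over the three ways of
  splitting the four positions into two pairs. Hence summing a coefficient over a common index
  placed at two positions \<open>r\<close>, \<open>s\<close> gives \<open>n\<close> times the coefficient plus the sum of the
  coefficients with \<open>s\<close> and one of the other positions exchanged, while the same sum collapses to a
  lower moment by orthogonality, resp. unitarity.

  On the orthogonal side \<open>n = d + 1\<close>. On the circular orthogonal side \<open>n = d\<close>; exchanges between the
  entries and the conjugate entries do not contribute (invariance under a diagonal phase), and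
  exchanging the two indices of a single symmetric entry returns the original moment, which turns
  \<open>d\<close> into \<open>d + 1\<close>. So both moments satisfy the same linear recursion, with \<open>2 * k - 2\<close>
  off-diagonal terms of coefficient 1 and diagonal coefficient \<open>d + 1\<close>; diagonal dominance
  makes its solution unique.
\<close>

section \<open>Reflection invariant multilinear forms\<close>

abbreviation swap :: "'a \<Rightarrow> 'a \<Rightarrow> 'a \<Rightarrow> 'a" where
  "swap \<equiv> Transposition.transpose"

definition unit_fun :: "nat \<Rightarrow> nat \<Rightarrow> complex" where
  "unit_fun a = (\<lambda>t. if t = a then 1 else 0)"

text \<open>When c^2 + s^2 = 1 this is the orthogonal map with block [[c, s], [s, -c]] on the
  coordinates \<open>a\<close>, \<open>b\<close>. Its matrix is symmetric and real, so transposition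
  and conjugation leave it alone and one map serves both ensembles. The family contains the sign
  change of coordinate \<open>b\<close> (c = 1, s = 0) and the exchange of \<open>a\<close> and
  \<open>b\<close> (c = 0, s = 1).\<close>

definition reflect :: "nat \<Rightarrow> nat \<Rightarrow> real \<Rightarrow> real \<Rightarrow> (nat \<Rightarrow> complex) \<Rightarrow> nat \<Rightarrow> complex" where
  "reflect a b c s y =
     (\<lambda>t. if t = a then of_real c * y a + of_real s * y b
          else if t = b then of_real s * y a - of_real c * y b else y t)"

lemma reflect_unit_fun_fst: "a \<noteq> b \<Longrightarrow>
    reflect a b c s (unit_fun a) = (\<lambda>t. of_real c * unit_fun a t + of_real s * unit_fun b t)"
  and reflect_unit_fun_snd: "a \<noteq> b \<Longrightarrow>
    reflect a b c s (unit_fun b) = (\<lambda>t. of_real s * unit_fun a t + (- of_real c) * unit_fun b t)"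
  and reflect_unit_fun_other: "x \<noteq> a \<Longrightarrow> x \<noteq> b \<Longrightarrow> reflect a b c s (unit_fun x) = unit_fun x"
  by (auto simp: reflect_def unit_fun_def fun_eq_iff)

text \<open>The sign change kills terms with an odd number of \<open>B\<close>, and the exchange
  identifies the remaining ones in pairs. Expanding the invariance at \<open>A A A A\<close> then
  gives c^4 + s^4 times \<open>T A A A A\<close> plus 2 c^2 s^2 times the sum of the three
  splittings. As 1 - c^4 - s^4 = 2 c^2 s^2, one point with c s nonzero is enough.\<close>

lemma quadrilinear_reflection_invariant:
  fixes T :: "('v \<Rightarrow> complex) \<Rightarrow> ('v \<Rightarrow> complex) \<Rightarrow> ('v \<Rightarrow> complex) \<Rightarrow> ('v \<Rightarrow> complex) \<Rightarrow> complex"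
  assumes lin1: "\<And>p q x x' y z w. T (\<lambda>t. p * x t + q * x' t) y z w = p * T x y z w + q * T x' y z w"
    and lin2: "\<And>p q x y y' z w. T x (\<lambda>t. p * y t + q * y' t) z w = p * T x y z w + q * T x y' z w"
    and lin3: "\<And>p q x y z z' w. T x y (\<lambda>t. p * z t + q * z' t) w = p * T x y z w + q * T x y z' w"
    and lin4: "\<And>p q x y z w w'. T x y z (\<lambda>t. p * w t + q * w' t) = p * T x y z w + q * T x y z w'"
    and inv: "\<And>c s :: real. \<And>x y z w. c\<^sup>2 + s\<^sup>2 = 1 \<Longrightarrow>
      T (R c s x) (R c s y) (R c s z) (R c s w) = T x y z w"
    and RA: "\<And>c s. R c s A = (\<lambda>t. of_real c * A t + of_real s * B t)"
    and RB: "\<And>c s. R c s B = (\<lambda>t. of_real s * A t + (- of_real c) * B t)"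
  shows "T A A A A = T A A B B + T B A B A + T A B B A"
proof -
  note lin = lin1 lin2 lin3 lin4
  note RAB = RA RB
  have odd: "T A A A B = 0" "T A A B A = 0" "T A B A A = 0" "T B A A A = 0"
    "T B B B A = 0" "T B B A B = 0" "T B A B B = 0" "T A B B B = 0"
    using inv[of 1 0 A A A B] inv[of 1 0 A A B A] inv[of 1 0 A B A A] inv[of 1 0 B A A A]
      inv[of 1 0 B B B A] inv[of 1 0 B B A B] inv[of 1 0 B A B B] inv[of 1 0 A B B B]
    unfolding RAB lin by simp_all
  have swap: "T B B B B = T A A A A" "T B B A A = T A A B B" "T A B A B = T B A B A"
    "T B A A B = T A B B A"
    using inv[of 0 1 A A A A] inv[of 0 1 A A B B] inv[of 0 1 B A B A] inv[of 0 1 A B B A]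
    unfolding RAB lin by simp_all
  \<comment> \<open>Any rational point of the unit circle off the axes would do; it avoids square roots.\<close>
  have "(3/5)\<^sup>2 + (4/5)\<^sup>2 = (1::real)" by (simp add: power2_eq_square)
  \<comment> \<open>The numeral is 288 * 5^10, that is 2 c^2 s^2 = 288/625 scaled by 5^14 in
    clearing denominators.\<close>
  from inv[OF this, of A A A A]
  have "2812500000 * T A A A A = 2812500000 * (T A A B B + T B A B A + T A B B A)"
    unfolding RAB lin odd swap by (simp add: field_simps)
  then show ?thesis unfolding mult_cancel_left by (rule disjE) simp_all
qed

text \<open>In the two instances below, \<open>P\<close> consists of the row index slots of a
  product of orthogonal entries, or of both index slots of every entry of a symmetric unitary
  matrix.\<close>

locale invariant_form =
  fixes n :: nat and P :: "'p set" and \<Phi> :: "('p \<Rightarrow> nat \<Rightarrow> complex) \<Rightarrow> complex"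
  assumes linear: "x \<in> P \<Longrightarrow>
      \<Phi> (v(x := \<lambda>t. p * y t + q * z t)) = p * \<Phi> (v(x := y)) + q * \<Phi> (v(x := z))"
    and cong: "(\<And>x. x \<in> P \<Longrightarrow> v x = w x) \<Longrightarrow> \<Phi> v = \<Phi> w"
    and reflect_invariant: "a < n \<Longrightarrow> b < n \<Longrightarrow> a \<noteq> b \<Longrightarrow> c\<^sup>2 + s\<^sup>2 = 1 \<Longrightarrow>
      \<Phi> (\<lambda>x. reflect a b c s (v x)) = \<Phi> v"
begin

definition component :: "('p \<Rightarrow> nat) \<Rightarrow> complex" where
  "component f = \<Phi> (\<lambda>x. unit_fun (f x))"

lemma component_cong: "(\<And>x. x \<in> P \<Longrightarrow> f x = g x) \<Longrightarrow> component f = component g"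
  unfolding component_def by (rule cong) simp

text \<open>The reflection with c = 0, s = 1 exchanges two basis vectors, so index values may be
  renamed.\<close>

lemma component_transpose:
  assumes "a < n" "b < n"
  shows "component (\<lambda>x. swap a b (f x)) = component f"
proof (cases "a = b")
  case False
  have "reflect a b 0 1 (unit_fun t) = unit_fun (swap a b t)" for t
    using False by (auto simp: reflect_def unit_fun_def fun_eq_iff Transposition.transpose_def)
  then show ?thesis
    using reflect_invariant[OF assms False, of 0 1 "\<lambda>x. unit_fun (f x)"] by (simp add: component_def)
qed simp

text \<open>Positions carrying a basis vector other than \<open>a\<close> and \<open>b\<close> are
  fixed by the reflection and can be frozen. What remains is a quadrilinear form in the four chosen
  positions.\<close>

lemma component_four:
  assumes ab: "a < n" "b < n" "a \<noteq> b"
    and mem: "w1 \<in> P" "w2 \<in> P" "w3 \<in> P" "w4 \<in> P"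
    and dist: "distinct [w1, w2, w3, w4]"
    and other: "\<And>x. x \<in> P - {w1, w2, w3, w4} \<Longrightarrow> f x \<noteq> a \<and> f x \<noteq> b"
  shows "component (f(w1 := a, w2 := a, w3 := a, w4 := a)) =
    component (f(w1 := a, w2 := a, w3 := b, w4 := b)) +
    component (f(w1 := b, w2 := a, w3 := b, w4 := a)) +
    component (f(w1 := a, w2 := b, w3 := b, w4 := a))"
proof -
  define T where "T x y z w = \<Phi> ((\<lambda>p. unit_fun (f p))(w1 := x, w2 := y, w3 := z, w4 := w))"
    for x y z w
  have component_T: "component (f(w1 := x, w2 := y, w3 := z, w4 := w)) =
      T (unit_fun x) (unit_fun y) (unit_fun z) (unit_fun w)" for x y z w
    unfolding component_def T_def by (rule cong) simp
  show ?thesis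
    unfolding component_T
  proof (rule quadrilinear_reflection_invariant[where R = "reflect a b"])
    fix p q x x' y z w
    \<comment> \<open>\<open>linear\<close> concerns the outermost update, so the slot under
      consideration is moved to the end; this is harmless for distinct slots.\<close>
    have eq: "T x y z w = \<Phi> ((\<lambda>p. unit_fun (f p))(w2 := y, w3 := z, w4 := w, w1 := x))" for x
      unfolding T_def by (rule cong) (use dist in auto)
    show "T (\<lambda>t. p * x t + q * x' t) y z w = p * T x y z w + q * T x' y z w"
      unfolding eq by (rule linear) (rule mem)
  next
    fix p q x y y' z w
    have eq: "T x y z w = \<Phi> ((\<lambda>p. unit_fun (f p))(w1 := x, w3 := z, w4 := w, w2 := y))" for y
      unfolding T_def by (rule cong) (use dist in auto)
    show "T x (\<lambda>t. p * y t + q * y' t) z w = p * T x y z w + q * T x y' z w"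
      unfolding eq by (rule linear) (rule mem)
  next
    fix p q x y z z' w
    have eq: "T x y z w = \<Phi> ((\<lambda>p. unit_fun (f p))(w1 := x, w2 := y, w4 := w, w3 := z))" for z
      unfolding T_def by (rule cong) (use dist in auto)
    show "T x y (\<lambda>t. p * z t + q * z' t) w = p * T x y z w + q * T x y z' w"
      unfolding eq by (rule linear) (rule mem)
  next
    fix p q x y z w w'
    show "T x y z (\<lambda>t. p * w t + q * w' t) = p * T x y z w + q * T x y z w'"
      unfolding T_def by (rule linear) (rule mem)
  next
    fix c s :: real and x y z w
    assume "c\<^sup>2 + s\<^sup>2 = 1"
    from reflect_invariant[OF ab this, of "(\<lambda>p. unit_fun (f p))(w1 := x, w2 := y, w3 := z, w4 := w)"]
    have "T x y z w = \<Phi> (\<lambda>p. reflect a b c s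
        (((\<lambda>p. unit_fun (f p))(w1 := x, w2 := y, w3 := z, w4 := w)) p))"
      unfolding T_def by (rule sym)
    also have "\<dots> = T (reflect a b c s x) (reflect a b c s y) (reflect a b c s z) (reflect a b c s w)"
      unfolding T_def by (rule cong) (use other in \<open>auto simp: reflect_unit_fun_other\<close>)
    finally show "T (reflect a b c s x) (reflect a b c s y) (reflect a b c s z) (reflect a b c s w)
        = T x y z w" ..
  qed (use ab in \<open>simp_all add: reflect_unit_fun_fst reflect_unit_fun_snd\<close>)
qed

text \<open>For each common value \<open>t\<close> given to \<open>r\<close> and \<open>s\<close>,
  either \<open>t\<close> occurs at no other position, and renaming recovers \<open>f\<close>, or
  four positions carry \<open>t\<close>, and the splitting identity gives \<open>f\<close> plus one
  exchange with \<open>s\<close> for each of the other two positions.\<close>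

lemma sum_component_contract:
  assumes fin: "finite P" and rs: "r \<in> P" "s \<in> P" "r \<noteq> s" "f r = f s"
    and range: "f ` P \<subseteq> {..<n}"
    and pairing: "\<And>x. x \<in> P \<Longrightarrow> card {y \<in> P. f y = f x} = 2"
  shows "(\<Sum>t<n. component (f(r := t, s := t))) =
    of_nat n * component f + (\<Sum>x\<in>P - {r, s}. component (f \<circ> swap x s))"
proof -
  have fibre: "{y \<in> P. f y = f r} = {r, s}"
  proof (rule sym, rule card_subset_eq)
    show "card {r, s} = card {y \<in> P. f y = f r}"
      using pairing[OF rs(1)] rs(3) by simp
  qed (use fin rs in auto)
  have step: "component (f(r := t, s := t)) =
      component f + (\<Sum>x\<in>{x \<in> P - {r, s}. f x = t}. component (f \<circ> swap x s))" if t: "t < n" for t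
  proof (cases "\<exists>x\<in>P - {r, s}. f x = t")
    case False
    \<comment> \<open>Here \<open>t\<close> is either \<open>f r\<close> or a value not taken on
      \<open>P\<close>, so exchanging \<open>f r\<close> and \<open>t\<close> only touches
      \<open>r\<close> and \<open>s\<close>.\<close>
    have "component (f(r := t, s := t)) = component (\<lambda>x. swap (f r) t (f x))"
      by (rule component_cong) (use False rs fibre in \<open>auto simp: Transposition.transpose_def\<close>)
    also have "\<dots> = component f"
      by (rule component_transpose) (use rs range t in auto)
    also have "component f = component f +
        (\<Sum>x\<in>{x \<in> P - {r, s}. f x = t}. component (f \<circ> swap x s))"
    proof -
      have "{x \<in> P - {r, s}. f x = t} = {}"
        using False by auto
      then show ?thesis by (simp only: sum.empty add_0_right)
    qed
    finally show ?thesis .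
  next
    case True
    then obtain x where x: "x \<in> P" "x \<noteq> r" "x \<noteq> s" "f x = t" by auto
    have "f r \<noteq> t" using x fibre by blast
    obtain u v where uv: "{y \<in> P. f y = t} = {u, v}" "u \<noteq> v"
      using pairing[OF x(1)] x(4) unfolding card_2_iff by blast
    then have mem: "u \<in> P" "v \<in> P" "f u = t" "f v = t" by blast+
    have dist: "distinct [u, v, r, s]"
      using uv(2) mem rs(3,4) \<open>f r \<noteq> t\<close> by (metis distinct_length_2_or_more distinct_singleton)
    have eq: "{x \<in> P - {r, s}. f x = t} = {u, v}"
      using uv(1) dist unfolding set_eq_iff by (metis (no_types, lifting) Diff_iff distinct_length_2_or_more insert_iff empty_iff mem_Collect_eq)
    have "component (f(r := t, s := t)) = component (f(u := t, v := t, r := t, s := t))"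
      by (rule component_cong) (use mem in auto)
    also have "\<dots> = component (f(u := t, v := t, r := f r, s := f r)) +
        component (f(u := f r, v := t, r := f r, s := t)) + component (f(u := t, v := f r, r := f r, s := t))"
    proof (rule component_four)
      show "f x \<noteq> t \<and> f x \<noteq> f r" if "x \<in> P - {u, v, r, s}" for x
        using that uv(1) fibre by blast
    qed (use mem rs range t dist \<open>f r \<noteq> t\<close> in auto)
    also have "component (f(u := t, v := t, r := f r, s := f r)) = component f"
      by (rule component_cong) (use mem rs in auto)
    also have "component (f(u := f r, v := t, r := f r, s := t)) = component (f \<circ> swap u s)"
      by (rule component_cong) (use mem rs dist in \<open>auto simp: Transposition.transpose_def\<close>)
    also have "component (f(u := t, v := f r, r := f r, s := t)) = component (f \<circ> swap v s)"
      by (rule component_cong) (use mem rs dist in \<open>auto simp: Transposition.transpose_def\<close>)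
    also have "component f + component (f \<circ> swap u s) + component (f \<circ> swap v s) =
        component f + (\<Sum>x\<in>{x \<in> P - {r, s}. f x = t}. component (f \<circ> swap x s))"
      unfolding eq using uv(2) by (simp add: add.assoc)
    finally show ?thesis .
  qed
  have "(\<Sum>t<n. component (f(r := t, s := t))) = (\<Sum>t<n. component f +
      (\<Sum>x\<in>{x \<in> P - {r, s}. f x = t}. component (f \<circ> swap x s)))"
    using step by (intro sum.cong) simp_all
  \<comment> \<open>Each remaining position lies in the fibre of exactly one \<open>t\<close>, so
    the inner sums join to one sum over all of them.\<close>
  also have "\<dots> = of_nat n * component f + (\<Sum>x\<in>P - {r, s}. component (f \<circ> swap x s))"
    using fin range by (subst sum.distrib, subst sum.group) auto
  finally show ?thesis .
qed

end

section \<open>Moments of the orthogonal group\<close>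

definition reflect_entry :: "nat \<Rightarrow> nat \<Rightarrow> real \<Rightarrow> real \<Rightarrow> nat \<Rightarrow> nat \<Rightarrow> real" where
  "reflect_entry a b c s p q =
     (if p = a then if q = a then c else if q = b then s else 0
      else if p = b then if q = a then s else if q = b then - c else 0
      else if p = q then 1 else 0)"

lemma reflect_entry_commute: "reflect_entry a b c s p q = reflect_entry a b c s q p"
  by (auto simp: reflect_entry_def)

lemma sum_reflect_entry:
  fixes y :: "nat \<Rightarrow> complex"
  assumes "a < n" "b < n" "a \<noteq> b" "p < n"
  shows "(\<Sum>q<n. of_real (reflect_entry a b c s p q) * y q) = reflect a b c s y p"
proof -
  have "(\<Sum>q<n. of_real (reflect_entry a b c s p q) * y q) =
      (\<Sum>q<n. (if q = a then of_real (reflect_entry a b c s p a) * y a else 0) +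
        (if q = b then of_real (reflect_entry a b c s p b) * y b else 0) +
        (if q = p then (if p = a \<or> p = b then 0 else y p) else 0))"
    by (intro sum.cong) (use assms in \<open>auto simp: reflect_entry_def\<close>)
  also have "\<dots> = reflect a b c s y p"
    using assms by (simp add: sum.distrib) (simp add: reflect_def reflect_entry_def)
  finally show ?thesis .
qed

lemma reflect_entry_orthogonal:
  assumes ab: "a < n" "b < n" "a \<noteq> b" and cs: "c\<^sup>2 + s\<^sup>2 = 1" and p: "p < n" "p' < n"
  shows "(\<Sum>q<n. reflect_entry a b c s p q * reflect_entry a b c s p' q) = (if p = p' then 1 else 0)"
proof -
  have cs': "complex_of_real c * of_real c + of_real s * of_real s = 1"
    using cs by (simp flip: of_real_mult of_real_add add: power2_eq_square)
  \<comment> \<open>Row \<open>p'\<close> is itself treated as a vector to be reflected, which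
    evaluates the product of the matrix with its transpose.\<close>
  have "complex_of_real (\<Sum>q<n. reflect_entry a b c s p q * reflect_entry a b c s p' q) =
      reflect a b c s (\<lambda>q. of_real (reflect_entry a b c s p' q)) p"
    by (simp flip: sum_reflect_entry[OF ab p(1)])
  also have "\<dots> = (if p = p' then 1 else 0)"
    using ab(3) cs' by (simp add: reflect_def reflect_entry_def algebra_simps)
  finally show ?thesis
    by (metis of_real_0 of_real_1 of_real_eq_iff)
qed

section \<open>Orthogonal matrices\<close>

lemma index_mat_sum:
  assumes "A \<in> carrier_mat n m" "B \<in> carrier_mat m k" "p < n" "q < k"
  shows "(A * B) $$ (p, q) = (\<Sum>t<m. A $$ (p, t) * B $$ (t, q))"
  using assms by (auto simp: scalar_prod_def lessThan_atLeast0)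

lemma orthogonal_group_iff:
  "g \<in> orthogonal_group n \<longleftrightarrow> g \<in> carrier_mat n n \<and>
     (\<forall>p<n. \<forall>q<n. (\<Sum>t<n. g $$ (p, t) * g $$ (q, t)) = (if p = q then 1 else 0))"
proof (cases "g \<in> carrier_mat n n")
  case True
  then have "(g * g\<^sup>T) $$ (p, q) = (\<Sum>t<n. g $$ (p, t) * g $$ (q, t))" if "p < n" "q < n" for p q
    using that by (subst index_mat_sum[of _ n n _ n]) auto
  then show ?thesis
    using True by (auto simp: orthogonal_group_def mat_eq_iff)
qed (auto simp: orthogonal_group_def)

lemma orthogonal_group_carrier: "g \<in> orthogonal_group n \<Longrightarrow> g \<in> carrier_mat n n"
  by (simp add: orthogonal_group_def)

lemma orthogonal_group_transpose:
  assumes "g \<in> orthogonal_group n" shows "g\<^sup>T \<in> orthogonal_group n"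
  using assms mat_mult_left_right_inverse[of g n "g\<^sup>T"] by (auto simp: orthogonal_group_def)

text \<open>The contraction below sums over a row index and thus needs orthonormal columns, while
  the definition gives orthonormal rows; closure under transposition links the two.\<close>

lemma orthogonal_group_columns:
  assumes "g \<in> orthogonal_group n" "p < n" "q < n"
  shows "(\<Sum>t<n. g $$ (t, p) * g $$ (t, q)) = (if p = q then 1 else 0)"
  using orthogonal_group_transpose[OF assms(1)] assms orthogonal_group_carrier[OF assms(1)]
  by (auto simp: orthogonal_group_iff)

lemma orthogonal_group_mult:
  assumes "g \<in> orthogonal_group n" "h \<in> orthogonal_group n" shows "g * h \<in> orthogonal_group n"
proof -
  note c = assms[THEN orthogonal_group_carrier]
  have "(g * h) * (g * h)\<^sup>T = g * (h * h\<^sup>T) * g\<^sup>T"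
    using c by (simp add: transpose_mult[of _ n n _ n] assoc_mult_mat[of _ n n _ n _ n])
  then show ?thesis
    using assms c by (auto simp: orthogonal_group_def)
qed

lemma orthogonal_group_entry_bound:
  assumes "g \<in> orthogonal_group n" "p < n" "q < n" shows "\<bar>g $$ (p, q)\<bar> \<le> 1"
proof -
  have "(g $$ (p, q)) * g $$ (p, q) \<le> (\<Sum>t<n. g $$ (p, t) * g $$ (p, t))"
    using assms(3) by (intro member_le_sum) auto
  then show ?thesis
    using assms by (simp add: orthogonal_group_iff abs_square_le_1[symmetric] power2_eq_square)
qed

section \<open>Measurability of matrix-valued maps and bounds for expectations\<close>

lemma measurable_mat_entry:
  assumes "sets M = sets (mat_borel n X)" "p < n" "q < n"
  shows "(\<lambda>A. A $$ (p, q)) \<in> borel_measurable M"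
proof -
  have "(\<lambda>A. (\<lambda>ij\<in>{..<n} \<times> {..<n}. A $$ ij)) \<in> measurable (mat_borel n X) (Pi\<^sub>M ({..<n} \<times> {..<n}) (\<lambda>_. borel))"
    unfolding mat_borel_def by (rule measurable_vimage_algebra1) (auto simp: space_PiM)
  from measurable_compose[OF this measurable_component_singleton[of "(p, q)"]]
  have "(\<lambda>A. A $$ (p, q)) \<in> borel_measurable (mat_borel n X)"
    using assms by simp
  then show ?thesis
    using measurable_cong_sets[OF assms(1) refl] by blast
qed

text \<open>The sigma-algebra is generated by the entries, so checking entries suffices. This is
  applied to left translation and to the congruence action.\<close>

lemma measurable_mat_borel:
  assumes sets: "sets M = sets (mat_borel n X)" and T: "T \<in> space N \<rightarrow> X"
    and entries: "\<And>p q. p < n \<Longrightarrow> q < n \<Longrightarrow> (\<lambda>x. T x $$ (p, q)) \<in> borel_measurable N"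
  shows "T \<in> measurable N M"
proof -
  have "T \<in> measurable N (mat_borel n X)"
    unfolding mat_borel_def
    by (intro measurable_vimage_algebra2[OF T] measurable_restrict) (use entries in auto)
  then show ?thesis
    using measurable_cong_sets[OF refl sets] by blast
qed

text \<open>A non-integrable function has integral 0 by convention, so the bound needs no
  integrability.\<close>

lemma (in prob_space) norm_expectation_le:
  fixes f :: "'a \<Rightarrow> 'b::{banach, second_countable_topology}"
  assumes "\<And>x. x \<in> space M \<Longrightarrow> norm (f x) \<le> B" "0 \<le> B"
  shows "norm (expectation f) \<le> B"
proof (cases "integrable M f")
  case True
  have "norm (expectation f) \<le> expectation (\<lambda>x. norm (f x))"
    by simp
  also have "\<dots> \<le> expectation (\<lambda>x. B)"
    using True assms by (intro integral_mono) auto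
  finally show ?thesis by (simp add: prob_space)
qed (use assms in \<open>simp add: not_integrable_integral_eq\<close>)

text \<open>Complex-valued although the entries are real, in order to be a component of an
  \<open>invariant_form\<close> and comparable with the circular moment. The set \<open>A\<close> of
  positions varies because the recursion removes positions.\<close>

definition orthogonal_moment ::
    "real mat measure \<Rightarrow> 'p set \<Rightarrow> ('p \<Rightarrow> nat) \<Rightarrow> ('p \<Rightarrow> nat) \<Rightarrow> complex" where
  "orthogonal_moment \<mu> A i j = (\<integral>u. (\<Prod>x\<in>A. complex_of_real (u $$ (i x, j x))) \<partial>\<mu>)"

locale haar_orthogonal =
  fixes n :: nat and \<mu> :: "real mat measure"
  assumes haar: "is_Haar_orthogonal n \<mu>"
begin

lemma prob: "prob_space \<mu>" and space: "space \<mu> = orthogonal_group n"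
  and sets: "sets \<mu> = sets (mat_borel n (orthogonal_group n))"
  and left_invariant: "g \<in> orthogonal_group n \<Longrightarrow> distr \<mu> \<mu> (\<lambda>u. g * u) = \<mu>"
  using haar by (auto simp: is_Haar_orthogonal_def)

sublocale prob_space \<mu> by (rule prob)

lemma measurable_left_mult: "g \<in> orthogonal_group n \<Longrightarrow> (\<lambda>u. g * u) \<in> measurable \<mu> \<mu>"
proof (rule measurable_mat_borel[OF sets])
  fix p q assume g: "g \<in> orthogonal_group n" and "p < n" "q < n"
  then have "(\<lambda>u. \<Sum>t<n. g $$ (p, t) * u $$ (t, q)) \<in> borel_measurable \<mu>"
    by (intro borel_measurable_sum borel_measurable_times measurable_mat_entry[OF sets]) auto
  moreover have "(g * u) $$ (p, q) = (\<Sum>t<n. g $$ (p, t) * u $$ (t, q))" if "u \<in> space \<mu>" for u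
    using g that \<open>p < n\<close> \<open>q < n\<close> orthogonal_group_carrier unfolding space by (intro index_mat_sum) auto
  ultimately show "(\<lambda>u. (g * u) $$ (p, q)) \<in> borel_measurable \<mu>"
    by (simp cong: measurable_cong)
qed (auto simp: space orthogonal_group_mult)

text \<open>Putting a vector in place of the row index makes the moment multilinear in the rows; the
  columns stay fixed.\<close>

definition column_form :: "real mat \<Rightarrow> nat \<Rightarrow> (nat \<Rightarrow> complex) \<Rightarrow> complex" where
  "column_form u c y = (\<Sum>t<n. y t * of_real (u $$ (t, c)))"

lemma measurable_column_form: "c < n \<Longrightarrow> (\<lambda>u. column_form u c y) \<in> borel_measurable \<mu>"
  unfolding column_form_def
  by (intro borel_measurable_sum borel_measurable_times borel_measurable_const
    measurable_compose[OF measurable_mat_entry[OF sets] borel_measurable_of_real]) auto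

lemma norm_column_form_le:
  assumes "u \<in> orthogonal_group n" "c < n" shows "norm (column_form u c y) \<le> (\<Sum>t<n. norm (y t))"
proof -
  have "norm (y t * of_real (u $$ (t, c))) \<le> norm (y t)" if "t < n" for t
    using orthogonal_group_entry_bound[OF assms(1) that assms(2)]
    by (simp add: norm_mult mult_left_le)
  then show ?thesis
    unfolding column_form_def by (intro sum_norm_le) auto
qed

lemma column_form_linear: "column_form u c (\<lambda>t. p * y t + q * z t) = p * column_form u c y + q * column_form u c z"
  by (simp add: column_form_def sum.distrib sum_distrib_left algebra_simps)

lemma column_form_unit_fun: "a < n \<Longrightarrow> column_form u c (unit_fun a) = of_real (u $$ (a, c))"
  by (simp add: column_form_def unit_fun_def if_distrib[of "\<lambda>x. x * _"] cong: if_cong)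

lemma integrable_prod_column_form:
  assumes "finite A" "j ` A \<subseteq> {..<n}"
  shows "integrable \<mu> (\<lambda>u. \<Prod>x\<in>A. column_form u (j x) (v x))"
proof (rule integrable_const_bound)
  show "AE u in \<mu>. norm (\<Prod>x\<in>A. column_form u (j x) (v x)) \<le> (\<Prod>x\<in>A. \<Sum>t<n. norm (v x t))"
    using assms by (intro AE_I2) (auto simp: space prod_norm[symmetric] intro!: norm_column_form_le prod_mono)
  show "(\<lambda>u. \<Prod>x\<in>A. column_form u (j x) (v x)) \<in> borel_measurable \<mu>"
    using assms by (intro borel_measurable_prod measurable_column_form) auto
qed

text \<open>Left translation by the reflection matrix can be moved onto the vectors, because that
  matrix is symmetric; left invariance of the measure then gives invariance of the form.\<close>

lemma invariant_form:
  assumes A: "finite A" "j ` A \<subseteq> {..<n}"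
  shows "invariant_form n A (\<lambda>v. \<integral>u. (\<Prod>x\<in>A. column_form u (j x) (v x)) \<partial>\<mu>)"
proof
  fix x :: 'a and v p y q z assume x: "x \<in> A"
  have "(\<Prod>x'\<in>A. column_form u (j x') ((v(x := w)) x')) =
      column_form u (j x) w * (\<Prod>x'\<in>A - {x}. column_form u (j x') (v x'))" for w u
    using A x by (simp add: prod.remove)
  then have "(\<Prod>x'\<in>A. column_form u (j x') ((v(x := \<lambda>t. p * y t + q * z t)) x')) =
      p * (\<Prod>x'\<in>A. column_form u (j x') ((v(x := y)) x')) +
      q * (\<Prod>x'\<in>A. column_form u (j x') ((v(x := z)) x'))" for u
    by (simp only: column_form_linear) (simp add: algebra_simps)
  then show "(\<integral>u. (\<Prod>x'\<in>A. column_form u (j x') ((v(x := \<lambda>t. p * y t + q * z t)) x')) \<partial>\<mu>) =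
      p * (\<integral>u. (\<Prod>x'\<in>A. column_form u (j x') ((v(x := y)) x')) \<partial>\<mu>) +
      q * (\<integral>u. (\<Prod>x'\<in>A. column_form u (j x') ((v(x := z)) x')) \<partial>\<mu>)"
    using integrable_prod_column_form[OF A] by simp
next
  fix a b and c s :: real and v :: "'a \<Rightarrow> nat \<Rightarrow> complex"
  assume ab: "a < n" "b < n" "a \<noteq> b" and cs: "c\<^sup>2 + s\<^sup>2 = 1"
  define g where "g = mat n n (\<lambda>(p, q). reflect_entry a b c s p q)"
  have g: "g \<in> orthogonal_group n"
    using reflect_entry_orthogonal[OF ab cs] by (simp add: orthogonal_group_iff g_def)
  have eq: "column_form (g * u) e y = column_form u e (reflect a b c s y)"
    if "u \<in> orthogonal_group n" "e < n" for u e y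
  proof -
    have "column_form (g * u) e y = (\<Sum>t<n. \<Sum>q<n. of_real (reflect_entry a b c s q t) * y t * of_real (u $$ (q, e)))"
      unfolding column_form_def
    proof (intro sum.cong refl)
      fix t assume "t \<in> {..<n}"
      then have "(g * u) $$ (t, e) = (\<Sum>q<n. reflect_entry a b c s q t * u $$ (q, e))"
        using that orthogonal_group_carrier[OF g] orthogonal_group_carrier[OF that(1)]
        by (subst index_mat_sum[of _ n n _ n])
          (auto simp: g_def reflect_entry_commute[of a b c s t] intro!: sum.cong)
      then show "y t * of_real ((g * u) $$ (t, e)) =
          (\<Sum>q<n. of_real (reflect_entry a b c s q t) * y t * of_real (u $$ (q, e)))"
        by (simp add: sum_distrib_left mult_ac)
    qed
    also have "\<dots> = (\<Sum>q<n. (\<Sum>t<n. of_real (reflect_entry a b c s q t) * y t) * of_real (u $$ (q, e)))"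
      by (subst sum.swap) (simp add: sum_distrib_right)
    also have "\<dots> = column_form u e (reflect a b c s y)"
      using ab by (simp add: sum_reflect_entry column_form_def)
    finally show ?thesis .
  qed
  have "(\<integral>u. (\<Prod>x\<in>A. column_form u (j x) (reflect a b c s (v x))) \<partial>\<mu>) =
      (\<integral>u. (\<Prod>x\<in>A. column_form (g * u) (j x) (v x)) \<partial>\<mu>)"
    using A by (intro Bochner_Integration.integral_cong prod.cong) (auto simp: eq space)
  also have "\<dots> = (\<integral>u. (\<Prod>x\<in>A. column_form u (j x) (v x)) \<partial>distr \<mu> \<mu> (\<lambda>u. g * u))"
    using integrable_prod_column_form[OF A] by (intro integral_distr[symmetric] measurable_left_mult[OF g]) auto
  finally show "(\<integral>u. (\<Prod>x\<in>A. column_form u (j x) (reflect a b c s (v x))) \<partial>\<mu>) =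
      (\<integral>u. (\<Prod>x\<in>A. column_form u (j x) (v x)) \<partial>\<mu>)"
    using left_invariant[OF g] by simp
qed auto

text \<open>The sum over a common row index \<open>t\<close> at \<open>r\<close> and
  \<open>s\<close> is evaluated twice: by the splitting identity for the form, and under the
  integral, where it is the inner product of columns \<open>j r\<close> and
  \<open>j s\<close>.\<close>

lemma orthogonal_moment_contract:
  assumes A: "finite A" "i ` A \<subseteq> {..<n}" "j ` A \<subseteq> {..<n}"
    and rs: "r \<in> A" "s \<in> A" "r \<noteq> s" "i r = i s"
    and pairs: "\<And>x. x \<in> A \<Longrightarrow> card {y \<in> A. i y = i x} = 2"
  shows "of_nat n * orthogonal_moment \<mu> A i j +
      (\<Sum>x\<in>A - {r, s}. orthogonal_moment \<mu> A (i \<circ> swap x s) j) =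
    (if j r = j s then orthogonal_moment \<mu> (A - {r, s}) i j else 0)"
proof -
  interpret F: invariant_form n A "\<lambda>v. \<integral>u. (\<Prod>x\<in>A. column_form u (j x) (v x)) \<partial>\<mu>"
    by (rule invariant_form) (use A in auto)
  have component: "F.component f = orthogonal_moment \<mu> A f j" if "f ` A \<subseteq> {..<n}" for f
    unfolding F.component_def orthogonal_moment_def using that
    by (intro Bochner_Integration.integral_cong prod.cong refl column_form_unit_fun) auto
  have swap_range: "(i \<circ> swap x s) ` A \<subseteq> {..<n}" if "x \<in> A" for x
    using that A rs by (auto simp: Transposition.transpose_def image_subset_iff)
  have "of_nat n * orthogonal_moment \<mu> A i j +
      (\<Sum>x\<in>A - {r, s}. orthogonal_moment \<mu> A (i \<circ> swap x s) j) =
      of_nat n * F.component i + (\<Sum>x\<in>A - {r, s}. F.component (i \<circ> swap x s))"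
    using A swap_range by (simp add: component)
  also have "\<dots> = (\<Sum>t<n. F.component (i(r := t, s := t)))"
    by (rule F.sum_component_contract[symmetric]) (use A rs pairs in auto)
  also have "\<dots> = (\<Sum>t<n. orthogonal_moment \<mu> A (i(r := t, s := t)) j)"
    by (intro sum.cong component refl) (use A in auto)
  also have "\<dots> = (\<Sum>t<n. \<integral>u. (\<Prod>x\<in>A. column_form u (j x) (unit_fun ((i(r := t, s := t)) x))) \<partial>\<mu>)"
    unfolding orthogonal_moment_def using A
    by (intro sum.cong Bochner_Integration.integral_cong prod.cong refl column_form_unit_fun[symmetric]) auto
  also have "\<dots> = (\<integral>u. (\<Sum>t<n. \<Prod>x\<in>A. column_form u (j x) (unit_fun ((i(r := t, s := t)) x))) \<partial>\<mu>)"
    by (rule Bochner_Integration.integral_sum[symmetric])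
      (rule integrable_prod_column_form, use A in auto)
  also have "\<dots> = (\<integral>u. (\<Prod>x\<in>A - {r, s}. complex_of_real (u $$ (i x, j x))) *
      (if j r = j s then 1 else 0) \<partial>\<mu>)"
  proof (intro Bochner_Integration.integral_cong refl)
    fix u assume "u \<in> space \<mu>"
    then have u: "u \<in> orthogonal_group n" by (simp add: space)
    have "(\<Prod>x\<in>A. column_form u (j x) (unit_fun ((i(r := t, s := t)) x))) =
        (\<Prod>x\<in>A - {r, s}. complex_of_real (u $$ (i x, j x))) * of_real (u $$ (t, j r) * u $$ (t, j s))"
      if "t < n" for t
    proof -
      have "A = insert r (insert s (A - {r, s}))" using rs by auto
      then have "(\<Prod>x\<in>A. column_form u (j x) (unit_fun ((i(r := t, s := t)) x))) =
          (\<Prod>x\<in>insert r (insert s (A - {r, s})). column_form u (j x) (unit_fun ((i(r := t, s := t)) x)))"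
        by (rule arg_cong)
      also have "\<dots> = of_real (u $$ (t, j r)) * (of_real (u $$ (t, j s)) *
          (\<Prod>x\<in>A - {r, s}. column_form u (j x) (unit_fun ((i(r := t, s := t)) x))))"
        using A(1) rs that by (simp add: column_form_unit_fun)
      also have "(\<Prod>x\<in>A - {r, s}. column_form u (j x) (unit_fun ((i(r := t, s := t)) x))) =
          (\<Prod>x\<in>A - {r, s}. complex_of_real (u $$ (i x, j x)))"
        using A by (intro prod.cong refl) (auto simp: column_form_unit_fun image_subset_iff)
      finally show ?thesis
        unfolding of_real_mult by (simp only: mult_ac)
    qed
    then have "(\<Sum>t<n. \<Prod>x\<in>A. column_form u (j x) (unit_fun ((i(r := t, s := t)) x))) =
      (\<Prod>x\<in>A - {r, s}. complex_of_real (u $$ (i x, j x))) *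
        of_real (\<Sum>t<n. u $$ (t, j r) * u $$ (t, j s))"
      by (simp add: sum_distrib_left)
    also have "complex_of_real (\<Sum>t<n. u $$ (t, j r) * u $$ (t, j s)) = (if j r = j s then 1 else 0)"
      using A rs by (subst orthogonal_group_columns[OF u]) (auto simp: image_subset_iff)
    finally show "(\<Sum>t<n. \<Prod>x\<in>A. column_form u (j x) (unit_fun ((i(r := t, s := t)) x))) =
      (\<Prod>x\<in>A - {r, s}. complex_of_real (u $$ (i x, j x))) * (if j r = j s then 1 else 0)" .
  qed
  also have "\<dots> = (if j r = j s then orthogonal_moment \<mu> (A - {r, s}) i j else 0)"
    by (simp add: orthogonal_moment_def)
  finally show ?thesis .
qed

lemma norm_orthogonal_moment_le:
  assumes "i ` A \<subseteq> {..<n}" "j ` A \<subseteq> {..<n}"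
  shows "norm (orthogonal_moment \<mu> A i j) \<le> 1"
proof -
  show ?thesis
    unfolding orthogonal_moment_def
  proof (rule norm_expectation_le)
    fix u assume "u \<in> space \<mu>"
    then show "norm (\<Prod>x\<in>A. complex_of_real (u $$ (i x, j x))) \<le> 1"
      using assms unfolding prod_norm[symmetric] space
      by (intro prod_le_1) (auto simp: image_subset_iff orthogonal_group_entry_bound)
  qed simp
qed

end

section \<open>Moments of the circular orthogonal ensemble\<close>

text \<open>The flag lets plain and conjugated entries share a single product over labels.\<close>

definition cnj_if :: "bool \<Rightarrow> complex \<Rightarrow> complex" where
  "cnj_if k z = (if k then cnj z else z)"

lemma cnj_if_simps [simp]:
  "cnj_if k (x * y) = cnj_if k x * cnj_if k y" "cnj_if k (sum f S) = (\<Sum>x\<in>S. cnj_if k (f x))"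
  "cnj_if k (of_real r) = of_real r" "norm (cnj_if k x) = norm x"
  by (simp_all add: cnj_if_def)

lemma measurable_cnj_if [measurable (raw)]:
  assumes "f \<in> borel_measurable M" shows "(\<lambda>x. cnj_if k (f x)) \<in> borel_measurable M"
proof -
  have "continuous_on UNIV (cnj_if k)"
    unfolding cnj_if_def by (cases k) (auto intro!: continuous_intros)
  from measurable_compose[OF assms borel_measurable_continuous_onI[OF this]] show ?thesis .
qed

interpretation cnj: comm_ring_hom cnj
  by unfold_locales auto

section \<open>Unitary matrices\<close>

lemma mat_adjoint_eq: "g \<in> carrier_mat n n \<Longrightarrow> mat_adjoint g = map_mat cnj (g\<^sup>T)"
  by (intro eq_matI) (auto simp: mat_adjoint_def mat_of_rows_def)

lemma unitary_group_carrier: "g \<in> unitary_group n \<Longrightarrow> g \<in> carrier_mat n n"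
  by (simp add: unitary_group_def)

lemma unitary_group_iff:
  "g \<in> unitary_group n \<longleftrightarrow> g \<in> carrier_mat n n \<and>
     (\<forall>p<n. \<forall>q<n. (\<Sum>t<n. g $$ (p, t) * cnj (g $$ (q, t))) = (if p = q then 1 else 0))"
proof (cases "g \<in> carrier_mat n n")
  case True
  then have "(g * mat_adjoint g) $$ (p, q) = (\<Sum>t<n. g $$ (p, t) * cnj (g $$ (q, t)))"
    if "p < n" "q < n" for p q
    using that by (subst index_mat_sum[of _ n n _ n]) (auto simp: mat_adjoint_eq)
  then show ?thesis
    using True by (auto simp: unitary_group_def mat_eq_iff mat_adjoint_eq)
qed (auto simp: unitary_group_def)

lemma unitary_group_mult:
  assumes "g \<in> unitary_group n" "h \<in> unitary_group n" shows "g * h \<in> unitary_group n"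
proof -
  note c = assms[THEN unitary_group_carrier]
  have "mat_adjoint (g * h) = mat_adjoint h * mat_adjoint g"
    using c cnj.mat_hom_mult[of "h\<^sup>T" n n "g\<^sup>T" n]
    by (simp add: mat_adjoint_eq[of _ n] transpose_mult[of _ n n _ n])
  moreover have "mat_adjoint g \<in> carrier_mat n n" "mat_adjoint h \<in> carrier_mat n n"
    using c by (auto simp: mat_adjoint_eq)
  ultimately have "(g * h) * mat_adjoint (g * h) = g * (h * mat_adjoint h) * mat_adjoint g"
    using c by (simp add: assoc_mult_mat[of _ n n _ n _ n])
  then show ?thesis
    using assms c by (auto simp: unitary_group_def)
qed

text \<open>The adjoint is also a left inverse, and transposing that identity gives the claim. It is
  needed because the action multiplies by the transpose of \<open>g\<close> on the right.\<close>

lemma unitary_group_transpose: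
  assumes "g \<in> unitary_group n" shows "g\<^sup>T \<in> unitary_group n"
proof -
  note c = assms[THEN unitary_group_carrier]
  have ca: "mat_adjoint g \<in> carrier_mat n n"
    using c by (simp add: mat_adjoint_eq)
  have "mat_adjoint g * g = 1\<^sub>m n"
    using mat_mult_left_right_inverse[OF c ca] assms by (simp add: unitary_group_def)
  then have "(mat_adjoint g * g)\<^sup>T = 1\<^sub>m n"
    by simp
  then have "g\<^sup>T * (mat_adjoint g)\<^sup>T = 1\<^sub>m n"
    using transpose_mult[OF ca c] by simp
  moreover have "(mat_adjoint g)\<^sup>T = mat_adjoint (g\<^sup>T)"
    using c by (auto simp: mat_adjoint_eq[of _ n] intro!: eq_matI)
  ultimately show ?thesis
    using c by (simp add: unitary_group_def)
qed

lemma unitary_group_entry_bound: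
  assumes "g \<in> unitary_group n" "p < n" "q < n" shows "norm (g $$ (p, q)) \<le> 1"
proof -
  have "(norm (g $$ (p, q)))\<^sup>2 \<le> (\<Sum>t<n. (norm (g $$ (p, t)))\<^sup>2)"
    using assms(3) by (intro member_le_sum) auto
  also have "complex_of_real (\<Sum>t<n. (norm (g $$ (p, t)))\<^sup>2) = 1"
    using assms by (simp only: unitary_group_iff of_real_sum complex_norm_square) simp
  then have "(\<Sum>t<n. (norm (g $$ (p, t)))\<^sup>2) = 1"
    by (metis of_real_1 of_real_eq_iff)
  finally show ?thesis
    using power2_le_imp_le[of "norm (g $$ (p, q))" 1] by simp
qed

section \<open>Symmetric unitary matrices and the congruence action\<close>

lemma COE_unitary: "s \<in> COE n \<Longrightarrow> s \<in> unitary_group n"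
  by (simp add: COE_def)

lemma COE_entry_commute: "s \<in> COE n \<Longrightarrow> p < n \<Longrightarrow> q < n \<Longrightarrow> s $$ (p, q) = s $$ (q, p)"
  using index_transpose_mat(1)[of q s p] unitary_group_carrier[of s n] by (auto simp: COE_def)

lemma COE_act:
  assumes "g \<in> unitary_group n" "s \<in> COE n" shows "g * s * g\<^sup>T \<in> COE n"
proof -
  note c = unitary_group_carrier[OF assms(1)] unitary_group_carrier[OF COE_unitary[OF assms(2)]]
  have "(g * s * g\<^sup>T)\<^sup>T = g * (s\<^sup>T * g\<^sup>T)"
    using c by (simp add: transpose_mult[of _ n n _ n])
  also have "\<dots> = g * s * g\<^sup>T"
    using assms(2) c by (simp add: COE_def assoc_mult_mat[of _ n n _ n _ n])
  moreover have "g * s * g\<^sup>T \<in> unitary_group n"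
    using assms by (intro unitary_group_mult unitary_group_transpose COE_unitary[of s])
  ultimately show ?thesis
    by (simp add: COE_def)
qed

lemma index_mat_congruence:
  assumes "g \<in> carrier_mat n n" "s \<in> carrier_mat n n" "p < n" "q < n"
  shows "(g * s * g\<^sup>T) $$ (p, q) = (\<Sum>u<n. \<Sum>t<n. g $$ (p, t) * s $$ (t, u) * g $$ (q, u))"
proof -
  have "(g * s * g\<^sup>T) $$ (p, q) = (\<Sum>u<n. (g * s) $$ (p, u) * g\<^sup>T $$ (u, q))"
    using assms by (intro index_mat_sum[of _ n n _ n]) auto
  also have "\<dots> = (\<Sum>u<n. \<Sum>t<n. g $$ (p, t) * s $$ (t, u) * g $$ (q, u))"
  proof (intro sum.cong refl)
    fix u assume "u \<in> {..<n}"
    then have "(g * s) $$ (p, u) = (\<Sum>t<n. g $$ (p, t) * s $$ (t, u))"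
      using assms by (intro index_mat_sum[of _ n n _ n]) auto
    moreover have "g\<^sup>T $$ (u, q) = g $$ (q, u)"
      using assms \<open>u \<in> {..<n}\<close> by auto
    ultimately show "(g * s) $$ (p, u) * g\<^sup>T $$ (u, q) = (\<Sum>t<n. g $$ (p, t) * s $$ (t, u) * g $$ (q, u))"
      by (simp only: sum_distrib_right)
  qed
  finally show ?thesis .
qed

text \<open>
  A label \<open>c\<close> stands for one matrix entry, with row index \<open>h (c, False)\<close> and column index
  \<open>h (c, True)\<close>; \<open>\<kappa>\<close> marks the conjugated entries.
\<close>
definition COE_moment ::
    "complex mat measure \<Rightarrow> 'c set \<Rightarrow> ('c \<Rightarrow> bool) \<Rightarrow> ('c \<times> bool \<Rightarrow> nat) \<Rightarrow> complex" where
  "COE_moment \<nu> C \<kappa> h = (\<integral>s. (\<Prod>c\<in>C. cnj_if (\<kappa> c) (s $$ (h (c, False), h (c, True)))) \<partial>\<nu>)"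

locale coe =
  fixes n :: nat and \<nu> :: "complex mat measure"
  assumes coe: "is_COE_measure n \<nu>"
begin

lemma prob: "prob_space \<nu>" and space: "space \<nu> = COE n"
  and sets: "sets \<nu> = sets (mat_borel n (COE n))"
  and invariant: "g \<in> unitary_group n \<Longrightarrow> distr \<nu> \<nu> (\<lambda>s. g * s * g\<^sup>T) = \<nu>"
  using coe by (auto simp: is_COE_measure_def)

sublocale prob_space \<nu> by (rule prob)

lemma measurable_congruence: "g \<in> unitary_group n \<Longrightarrow> (\<lambda>s. g * s * g\<^sup>T) \<in> measurable \<nu> \<nu>"
proof (rule measurable_mat_borel[OF sets])
  fix p q assume g: "g \<in> unitary_group n" and "p < n" "q < n"
  then have "(\<lambda>s. \<Sum>u<n. \<Sum>t<n. g $$ (p, t) * s $$ (t, u) * g $$ (q, u)) \<in> borel_measurable \<nu>"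
    by (intro borel_measurable_sum borel_measurable_times borel_measurable_const
      measurable_mat_entry[OF sets]) auto
  moreover have "(g * s * g\<^sup>T) $$ (p, q) = (\<Sum>u<n. \<Sum>t<n. g $$ (p, t) * s $$ (t, u) * g $$ (q, u))"
    if "s \<in> space \<nu>" for s
    using g that \<open>p < n\<close> \<open>q < n\<close> unitary_group_carrier COE_unitary unfolding space
    by (intro index_mat_congruence) auto
  ultimately show "(\<lambda>s. (g * s * g\<^sup>T) $$ (p, q)) \<in> borel_measurable \<nu>"
    by (simp cong: measurable_cong)
qed (auto simp: space COE_act)

text \<open>Only the matrix entry is conjugated, never the vectors, so the form is complex bilinear
  for both values of the flag, as \<open>invariant_form\<close> requires.\<close>

definition form :: "bool \<Rightarrow> complex mat \<Rightarrow> (nat \<Rightarrow> complex) \<Rightarrow> (nat \<Rightarrow> complex) \<Rightarrow> complex" where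
  "form k s x y = (\<Sum>p<n. \<Sum>q<n. x p * y q * cnj_if k (s $$ (p, q)))"

lemma measurable_form: "(\<lambda>s. form k s x y) \<in> borel_measurable \<nu>"
  unfolding form_def
  by (intro borel_measurable_sum borel_measurable_times borel_measurable_const measurable_cnj_if
    measurable_mat_entry[OF sets]) auto

lemma norm_form_le:
  assumes "s \<in> COE n" shows "norm (form k s x y) \<le> (\<Sum>p<n. \<Sum>q<n. norm (x p * y q))"
proof -
  have "norm (x p * y q * cnj_if k (s $$ (p, q))) \<le> norm (x p * y q)" if "p < n" "q < n" for p q
    using unitary_group_entry_bound[OF COE_unitary[OF assms] that]
    by (simp add: norm_mult mult_left_le)
  then show ?thesis
    unfolding form_def by (intro sum_norm_le) auto
qed

lemma form_linear:
  "form k s (\<lambda>t. p * x t + q * x' t) y = p * form k s x y + q * form k s x' y"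
  "form k s x (\<lambda>t. p * y t + q * y' t) = p * form k s x y + q * form k s x y'"
  by (simp_all add: form_def sum.distrib sum_distrib_left algebra_simps)

lemma form_unit_fun:
  assumes "a < n" "b < n" shows "form k s (unit_fun a) (unit_fun b) = cnj_if k (s $$ (a, b))"
proof -
  have "form k s (unit_fun a) (unit_fun b) =
      (\<Sum>p<n. if p = a then \<Sum>q<n. if q = b then cnj_if k (s $$ (a, b)) else 0 else 0)"
    unfolding form_def
  proof (intro sum.cong refl)
    fix p
    have "unit_fun a p * unit_fun b q * cnj_if k (s $$ (p, q)) =
        (if p = a then if q = b then cnj_if k (s $$ (a, b)) else 0 else 0)" for q
      by (simp add: unit_fun_def)
    then show "(\<Sum>q<n. unit_fun a p * unit_fun b q * cnj_if k (s $$ (p, q))) =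
        (if p = a then \<Sum>q<n. if q = b then cnj_if k (s $$ (a, b)) else 0 else 0)"
      by simp
  qed
  then show ?thesis using assms by simp
qed

text \<open>The congruence is moved onto the vectors: each is multiplied by the transpose of
  \<open>g\<close>, with \<open>g\<close> conjugated when the matrix entry is.\<close>

lemma form_congruence:
  assumes "g \<in> unitary_group n" "s \<in> COE n"
    and x: "\<And>p. p < n \<Longrightarrow> x' p = (\<Sum>t<n. cnj_if k (g $$ (t, p)) * x t)"
    and y: "\<And>p. p < n \<Longrightarrow> y' p = (\<Sum>t<n. cnj_if k (g $$ (t, p)) * y t)"
  shows "form k (g * s * g\<^sup>T) x y = form k s x' y'"
proof -
  note c = unitary_group_carrier[OF assms(1)] unitary_group_carrier[OF COE_unitary[OF assms(2)]]
  let ?G = "\<lambda>t p. cnj_if k (g $$ (t, p))" and ?S = "\<lambda>t p. cnj_if k (s $$ (t, p))"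
  have "form k (g * s * g\<^sup>T) x y =
      (\<Sum>p<n. \<Sum>q<n. \<Sum>u<n. \<Sum>t<n. ?G p t * x p * (?G q u * y q) * ?S t u)"
    unfolding form_def using c
    by (intro sum.cong refl, subst index_mat_congruence[of _ n])
      (auto simp: sum_distrib_left mult_ac)
  \<comment> \<open>Neighbouring sums are exchanged one pair at a time until \<open>t\<close> and
    \<open>u\<close> are outermost and the sums over \<open>p\<close> and \<open>q\<close>
    factor.\<close>
  also have "\<dots> = (\<Sum>p<n. \<Sum>u<n. \<Sum>q<n. \<Sum>t<n. ?G p t * x p * (?G q u * y q) * ?S t u)"
    by (intro sum.cong refl sum.swap)
  also have "\<dots> = (\<Sum>p<n. \<Sum>u<n. \<Sum>t<n. \<Sum>q<n. ?G p t * x p * (?G q u * y q) * ?S t u)"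
    by (intro sum.cong refl sum.swap)
  also have "\<dots> = (\<Sum>p<n. \<Sum>t<n. \<Sum>u<n. \<Sum>q<n. ?G p t * x p * (?G q u * y q) * ?S t u)"
    by (intro sum.cong refl sum.swap)
  also have "\<dots> = (\<Sum>t<n. \<Sum>p<n. \<Sum>u<n. \<Sum>q<n. ?G p t * x p * (?G q u * y q) * ?S t u)"
    by (rule sum.swap)
  also have "\<dots> = (\<Sum>t<n. \<Sum>u<n. \<Sum>p<n. \<Sum>q<n. ?G p t * x p * (?G q u * y q) * ?S t u)"
    by (intro sum.cong refl sum.swap)
  also have "\<dots> = form k s x' y'"
    unfolding form_def
  proof (intro sum.cong refl)
    fix t u assume "t \<in> {..<n}" "u \<in> {..<n}"
    then have "x' t * y' u = (\<Sum>p<n. \<Sum>q<n. ?G p t * x p * (?G q u * y q))"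
      by (simp add: x y sum_product)
    then show "(\<Sum>p<n. \<Sum>q<n. ?G p t * x p * (?G q u * y q) * ?S t u) = x' t * y' u * ?S t u"
      by (simp add: sum_distrib_right)
  qed
  finally show ?thesis .
qed

lemma integrable_prod_form:
  "integrable \<nu> (\<lambda>s. \<Prod>c\<in>C. form (\<kappa> c) s (v (c, False)) (v (c, True)))"
proof (rule integrable_const_bound)
  show "AE s in \<nu>. norm (\<Prod>c\<in>C. form (\<kappa> c) s (v (c, False)) (v (c, True))) \<le>
      (\<Prod>c\<in>C. \<Sum>p<n. \<Sum>q<n. norm (v (c, False) p * v (c, True) q))"
    by (intro AE_I2) (auto simp only: space prod_norm[symmetric] intro!: norm_form_le prod_mono norm_ge_zero conjI)
  show "(\<lambda>s. \<Prod>c\<in>C. form (\<kappa> c) s (v (c, False)) (v (c, True))) \<in> borel_measurable \<nu>"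
    by (intro borel_measurable_prod measurable_form)
qed

text \<open>Stated for arbitrary unitary \<open>g\<close> because it is used both for real
  reflections and for a diagonal phase.\<close>

lemma integral_prod_form_invariant:
  assumes g: "g \<in> unitary_group n"
    and w: "\<And>c b p. c \<in> C \<Longrightarrow> p < n \<Longrightarrow>
      w (c, b) p = (\<Sum>t<n. cnj_if (\<kappa> c) (g $$ (t, p)) * v (c, b) t)"
  shows "(\<integral>s. (\<Prod>c\<in>C. form (\<kappa> c) s (w (c, False)) (w (c, True))) \<partial>\<nu>) =
    (\<integral>s. (\<Prod>c\<in>C. form (\<kappa> c) s (v (c, False)) (v (c, True))) \<partial>\<nu>)"
proof -
  have "(\<integral>s. (\<Prod>c\<in>C. form (\<kappa> c) s (w (c, False)) (w (c, True))) \<partial>\<nu>) =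
      (\<integral>s. (\<Prod>c\<in>C. form (\<kappa> c) (g * s * g\<^sup>T) (v (c, False)) (v (c, True))) \<partial>\<nu>)"
    using w by (intro Bochner_Integration.integral_cong prod.cong refl form_congruence[symmetric] g)
      (auto simp: space)
  also have "\<dots> = (\<integral>s. (\<Prod>c\<in>C. form (\<kappa> c) s (v (c, False)) (v (c, True)))
      \<partial>distr \<nu> \<nu> (\<lambda>s. g * s * g\<^sup>T))"
    by (intro integral_distr[symmetric] measurable_congruence[OF g] borel_measurable_prod
      measurable_form)
  finally show ?thesis
    using invariant[OF g] by simp
qed

text \<open>Since the reflection matrix is real, slots of plain and of conjugated entries transform
  alike and can be treated as one set of positions.\<close>

lemma invariant_form:
  assumes C: "finite C"
  shows "invariant_form n (C \<times> UNIV)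
    (\<lambda>v. \<integral>s. (\<Prod>c\<in>C. form (\<kappa> c) s (v (c, False)) (v (c, True))) \<partial>\<nu>)"
proof
  fix x :: "'a \<times> bool" and v p y q z assume x: "x \<in> C \<times> UNIV"
  obtain c b where cb: "x = (c, b)" by (cases x)
  with x have c: "c \<in> C" by simp
  have split: "(\<Prod>c'\<in>C. form (\<kappa> c') s ((v(x := w)) (c', False)) ((v(x := w)) (c', True))) =
      form (\<kappa> c) s ((v(x := w)) (c, False)) ((v(x := w)) (c, True)) *
      (\<Prod>c'\<in>C - {c}. form (\<kappa> c') s (v (c', False)) (v (c', True)))" for w s
    using C c cb by (simp add: prod.remove)
  have "(\<Prod>c'\<in>C. form (\<kappa> c') s ((v(x := \<lambda>t. p * y t + q * z t)) (c', False))
        ((v(x := \<lambda>t. p * y t + q * z t)) (c', True))) =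
      p * (\<Prod>c'\<in>C. form (\<kappa> c') s ((v(x := y)) (c', False)) ((v(x := y)) (c', True))) +
      q * (\<Prod>c'\<in>C. form (\<kappa> c') s ((v(x := z)) (c', False)) ((v(x := z)) (c', True)))" for s
    unfolding split by (cases b) (simp_all add: cb form_linear algebra_simps)
  then show "(\<integral>s. (\<Prod>c'\<in>C. form (\<kappa> c') s ((v(x := \<lambda>t. p * y t + q * z t)) (c', False))
        ((v(x := \<lambda>t. p * y t + q * z t)) (c', True))) \<partial>\<nu>) =
      p * (\<integral>s. (\<Prod>c'\<in>C. form (\<kappa> c') s ((v(x := y)) (c', False)) ((v(x := y)) (c', True))) \<partial>\<nu>) +
      q * (\<integral>s. (\<Prod>c'\<in>C. form (\<kappa> c') s ((v(x := z)) (c', False)) ((v(x := z)) (c', True))) \<partial>\<nu>)"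
    by (simp only: Bochner_Integration.integral_add integrable_prod_form integrable_mult_right
      integral_mult_right_zero)
next
  fix a b and c s :: real and v :: "'a \<times> bool \<Rightarrow> nat \<Rightarrow> complex"
  assume ab: "a < n" "b < n" "a \<noteq> b" and cs: "c\<^sup>2 + s\<^sup>2 = 1"
  define g where "g = mat n n (\<lambda>(p, q). complex_of_real (reflect_entry a b c s p q))"
  have "g \<in> unitary_group n"
    using reflect_entry_orthogonal[OF ab cs]
    by (auto simp: unitary_group_iff g_def simp flip: of_real_mult of_real_sum)
  then show "(\<integral>\<sigma>. (\<Prod>e\<in>C. form (\<kappa> e) \<sigma> (reflect a b c s (v (e, False))) (reflect a b c s (v (e, True)))) \<partial>\<nu>) =
      (\<integral>\<sigma>. (\<Prod>e\<in>C. form (\<kappa> e) \<sigma> (v (e, False)) (v (e, True))) \<partial>\<nu>)"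
  proof (rule integral_prod_form_invariant[where w = "\<lambda>x. reflect a b c s (v x)"])
    fix e d p assume "p < n"
    then have "reflect a b c s (v (e, d)) p = (\<Sum>t<n. of_real (reflect_entry a b c s p t) * v (e, d) t)"
      by (rule sum_reflect_entry[OF ab, symmetric])
    also have "\<dots> = (\<Sum>t<n. cnj_if (\<kappa> e) (g $$ (t, p)) * v (e, d) t)"
      using \<open>p < n\<close> by (intro sum.cong) (simp_all add: g_def reflect_entry_commute[of a b c s p])
    finally show "reflect a b c s (v (e, d)) p = (\<Sum>t<n. cnj_if (\<kappa> e) (g $$ (t, p)) * v (e, d) t)" .
  qed
next
  fix v w :: "'a \<times> bool \<Rightarrow> nat \<Rightarrow> complex"
  assume eq: "\<And>x. x \<in> C \<times> UNIV \<Longrightarrow> v x = w x"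
  have "(\<Prod>c\<in>C. form (\<kappa> c) s (v (c, False)) (v (c, True))) =
      (\<Prod>c\<in>C. form (\<kappa> c) s (w (c, False)) (w (c, True)))" for s
    by (intro prod.cong refl) (simp add: eq)
  then show "(\<integral>s. (\<Prod>c\<in>C. form (\<kappa> c) s (v (c, False)) (v (c, True))) \<partial>\<nu>) =
      (\<integral>s. (\<Prod>c\<in>C. form (\<kappa> c) s (w (c, False)) (w (c, True))) \<partial>\<nu>)"
    by simp
qed

lemma component_eq_COE_moment:
  assumes C: "finite C" and h: "h ` (C \<times> UNIV) \<subseteq> {..<n}"
  shows "invariant_form.component
    (\<lambda>v. \<integral>s. (\<Prod>c\<in>C. form (\<kappa> c) s (v (c, False)) (v (c, True))) \<partial>\<nu>) h = COE_moment \<nu> C \<kappa> h"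
proof -
  have "(\<Prod>c\<in>C. form (\<kappa> c) s (unit_fun (h (c, False))) (unit_fun (h (c, True)))) =
      (\<Prod>c\<in>C. cnj_if (\<kappa> c) (s $$ (h (c, False), h (c, True))))" for s
    using h by (intro prod.cong refl form_unit_fun) auto
  then show ?thesis
    by (simp add: invariant_form.component_def[OF invariant_form[OF C]] COE_moment_def)
qed

text \<open>
  The index \<open>b\<close> occurs twice among the conjugated entries and nowhere else, so multiplying the
  \<open>b\<close>-th coordinate by \<open>\<i>\<close> changes the sign of the moment.
\<close>
lemma COE_moment_eq_0:
  fixes C :: "'c set"
  assumes C: "finite C" and h: "h ` (C \<times> UNIV) \<subseteq> {..<n}"
    and yz: "y \<in> C \<times> UNIV" "z \<in> C \<times> UNIV" "y \<noteq> z" "\<kappa> (fst y)" "\<kappa> (fst z)" "h y = b" "h z = b"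
    and other: "\<And>x. x \<in> C \<times> UNIV \<Longrightarrow> h x = b \<Longrightarrow> x = y \<or> x = z"
  shows "COE_moment \<nu> C \<kappa> h = 0"
proof -
  define \<Phi> where "\<Phi> = (\<lambda>v. \<integral>s. (\<Prod>c\<in>C. form (\<kappa> c) s (v (c, False)) (v (c, True))) \<partial>\<nu>)"
  interpret F: invariant_form n "C \<times> UNIV" \<Phi>
    unfolding \<Phi>_def by (rule invariant_form[OF C])
  define phase where "phase t = (if t = b then \<i> else 1)" for t
  define g where "g = mat n n (\<lambda>(p, q). if p = q then phase p else 0)"
  have g: "g \<in> unitary_group n"
  proof -
    have "(\<Sum>t<n. g $$ (p, t) * cnj (g $$ (q, t))) = (if p = q then 1 else 0)"
      if "p < n" "q < n" for p q
    proof -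
      have "(\<Sum>t<n. g $$ (p, t) * cnj (g $$ (q, t))) = (\<Sum>t<n. if t = p then if p = q then 1 else 0 else 0)"
        using that by (intro sum.cong) (auto simp: g_def phase_def)
      then show ?thesis using that by simp
    qed
    then show ?thesis by (auto simp: unitary_group_iff g_def)
  qed
  define v where "v = (\<lambda>x. unit_fun (h x))"
  define w where "w x = (\<lambda>t. cnj_if (\<kappa> (fst x)) (phase t) * v x t)" for x
  have "\<Phi> w = \<Phi> v"
    unfolding \<Phi>_def
  proof (rule integral_prod_form_invariant[OF g])
    fix c d p assume "p < n"
    then have "(\<Sum>t<n. cnj_if (\<kappa> c) (g $$ (t, p)) * v (c, d) t) =
        (\<Sum>t<n. if t = p then cnj_if (\<kappa> c) (phase p) * v (c, d) p else 0)"
      by (intro sum.cong) (auto simp: g_def cnj_if_def)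
    then show "w (c, d) p = (\<Sum>t<n. cnj_if (\<kappa> c) (g $$ (t, p)) * v (c, d) t)"
      using \<open>p < n\<close> by (simp add: w_def)
  qed
  \<comment> \<open>Both slots are conjugated, so each acquires the factor \<open>- \<i>\<close>,
    and together they give -1. The factor is written as a two-term combination with a zero second
    coefficient to fit \<open>linear\<close>.\<close>
  moreover have "\<Phi> w = \<Phi> (v(y := \<lambda>t. - \<i> * v y t + 0 * v y t, z := \<lambda>t. - \<i> * v z t + 0 * v z t))"
  proof (rule F.cong)
    fix x :: "'c \<times> bool" assume "x \<in> C \<times> UNIV"
    then consider "x = y" | "x = z" | "h x \<noteq> b"
      using other by blast
    then show "w x = (v(y := \<lambda>t. - \<i> * v y t + 0 * v y t,
        z := \<lambda>t. - \<i> * v z t + 0 * v z t)) x"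
    proof cases
      case 3
      then have "x \<noteq> y" "x \<noteq> z"
        using yz by auto
      with 3 show ?thesis
        by (simp add: w_def v_def fun_eq_iff phase_def unit_fun_def cnj_if_def)
    qed (use yz in \<open>simp_all add: w_def v_def fun_eq_iff phase_def unit_fun_def cnj_if_def\<close>)
  qed
  moreover have "\<dots> = - \<i> * \<Phi> (v(y := \<lambda>t. - \<i> * v y t + 0 * v y t))"
    using F.linear[OF yz(2), of "v(y := \<lambda>t. - \<i> * v y t + 0 * v y t)" "- \<i>" "v z" 0 "v z"] yz(3)
    by (simp add: fun_upd_idem)
  moreover have "\<dots> = - \<Phi> v"
    unfolding F.linear[OF yz(1)] by simp
  ultimately have "\<Phi> v = 0"
    by simp
  then show ?thesis
    using component_eq_COE_moment[OF C h, of \<kappa>] F.component_def[of h]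
    unfolding \<Phi>_def[symmetric] v_def by simp
qed

lemma norm_COE_moment_le:
  assumes "h ` (C \<times> UNIV) \<subseteq> {..<n}"
  shows "norm (COE_moment \<nu> C \<kappa> h) \<le> 1"
  unfolding COE_moment_def
proof (rule norm_expectation_le)
  fix s assume "s \<in> space \<nu>"
  then show "norm (\<Prod>c\<in>C. cnj_if (\<kappa> c) (s $$ (h (c, False), h (c, True)))) \<le> 1"
    using assms unfolding prod_norm[symmetric] space
    by (intro prod_le_1) (auto simp: image_subset_iff intro!: unitary_group_entry_bound[OF COE_unitary])
qed simp

text \<open>This is symmetry of the matrix. It supplies the extra copy of the original moment that
  turns the diagonal coefficient \<open>n\<close> into \<open>n + 1\<close>.\<close>

lemma COE_moment_flip:
  assumes C: "finite C" "c0 \<in> C" and h: "h ` (C \<times> UNIV) \<subseteq> {..<n}"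
  shows "COE_moment \<nu> C \<kappa> (h \<circ> swap (c0, False) (c0, True)) = COE_moment \<nu> C \<kappa> h"
  unfolding COE_moment_def
proof (intro Bochner_Integration.integral_cong prod.cong refl)
  fix s c assume "s \<in> space \<nu>" "c \<in> C"
  then have "s $$ (h (c0, True), h (c0, False)) = s $$ (h (c0, False), h (c0, True))"
    using C h by (intro COE_entry_commute) (auto simp: space image_subset_iff)
  then show "cnj_if (\<kappa> c) (s $$ ((h \<circ> swap (c0, False) (c0, True)) (c, False),
      (h \<circ> swap (c0, False) (c0, True)) (c, True))) =
    cnj_if (\<kappa> c) (s $$ (h (c, False), h (c, True)))"
    by (cases "c = c0") (simp_all add: Transposition.transpose_def)
qed

text \<open>Symmetry brings \<open>t\<close> to the column index of both entries; the sum over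
  \<open>t\<close> is then the Hermitian inner product of two rows, evaluated by unitarity.\<close>

lemma sum_COE_moment_update:
  assumes C: "finite C" and h: "h ` (C \<times> UNIV) \<subseteq> {..<n}"
    and c: "c0 \<in> C" "c1 \<in> C" "\<not> \<kappa> c0" "\<kappa> c1"
  shows "(\<Sum>t<n. COE_moment \<nu> C \<kappa> (h((c0, True) := t, (c1, b) := t))) =
    (if h (c0, False) = h (c1, \<not> b) then COE_moment \<nu> (C - {c0, c1}) \<kappa> h else 0)"
proof -
  let ?P = "\<lambda>h s. \<Prod>c\<in>C. cnj_if (\<kappa> c) (s $$ (h (c, False), h (c, True)))"
  let ?h = "\<lambda>t. h((c0, True) := t, (c1, b) := t)"
  let ?R = "\<lambda>s. \<Prod>c\<in>C - {c0, c1}. cnj_if (\<kappa> c) (s $$ (h (c, False), h (c, True)))"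
  have "c0 \<noteq> c1" using c by auto
  have int: "integrable \<nu> (?P (?h t))" if "t < n" for t
  proof -
    have "?P (?h t) s = (\<Prod>c\<in>C. form (\<kappa> c) s (unit_fun (?h t (c, False))) (unit_fun (?h t (c, True))))" for s
      using h that by (intro prod.cong refl form_unit_fun[symmetric]) (auto simp: image_subset_iff)
    then show ?thesis
      using integrable_prod_form[where C = C and \<kappa> = \<kappa> and v = "\<lambda>x. unit_fun (?h t x)"] by simp
  qed
  have "(\<Sum>t<n. COE_moment \<nu> C \<kappa> (?h t)) = (\<integral>s. (\<Sum>t<n. ?P (?h t) s) \<partial>\<nu>)"
    unfolding COE_moment_def using int by (intro Bochner_Integration.integral_sum[symmetric]) auto
  also have "\<dots> = (\<integral>s. ?R s * (if h (c0, False) = h (c1, \<not> b) then 1 else 0) \<partial>\<nu>)"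
  proof (intro Bochner_Integration.integral_cong refl)
    fix s assume "s \<in> space \<nu>"
    then have s: "s \<in> COE n" by (simp add: space)
    have "?P (?h t) s = ?R s * (s $$ (h (c0, False), t) * cnj (s $$ (h (c1, \<not> b), t)))" if "t < n" for t
    proof -
      have "C = insert c0 (insert c1 (C - {c0, c1}))" using c by auto
      then have "?P (?h t) s = (\<Prod>c\<in>insert c0 (insert c1 (C - {c0, c1})).
          cnj_if (\<kappa> c) (s $$ (?h t (c, False), ?h t (c, True))))"
        by (rule arg_cong)
      also have "\<dots> = cnj_if (\<kappa> c0) (s $$ (?h t (c0, False), ?h t (c0, True))) *
          (cnj_if (\<kappa> c1) (s $$ (?h t (c1, False), ?h t (c1, True))) *
          (\<Prod>c\<in>C - {c0, c1}. cnj_if (\<kappa> c) (s $$ (?h t (c, False), ?h t (c, True)))))"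
        using C \<open>c0 \<noteq> c1\<close> by simp
      also have "(\<Prod>c\<in>C - {c0, c1}. cnj_if (\<kappa> c) (s $$ (?h t (c, False), ?h t (c, True)))) = ?R s"
        by (intro prod.cong) auto
      also have "cnj_if (\<kappa> c0) (s $$ (?h t (c0, False), ?h t (c0, True))) = s $$ (h (c0, False), t)"
        using c \<open>c0 \<noteq> c1\<close> by (simp add: cnj_if_def)
      also have "cnj_if (\<kappa> c1) (s $$ (?h t (c1, False), ?h t (c1, True))) = cnj (s $$ (h (c1, \<not> b), t))"
        using c \<open>c0 \<noteq> c1\<close> that h COE_entry_commute[OF s that, of "h (c1, True)"]
        by (cases b) (auto simp: image_subset_iff cnj_if_def)
      finally show ?thesis
        by (simp only: mult_ac)
    qed
    then have "(\<Sum>t<n. ?P (?h t) s) =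
        ?R s * (\<Sum>t<n. s $$ (h (c0, False), t) * cnj (s $$ (h (c1, \<not> b), t)))"
      by (simp add: sum_distrib_left)
    also have "(\<Sum>t<n. s $$ (h (c0, False), t) * cnj (s $$ (h (c1, \<not> b), t))) =
        (if h (c0, False) = h (c1, \<not> b) then 1 else 0)"
      using COE_unitary[OF s] c h by (auto simp: unitary_group_iff image_subset_iff)
    finally show "(\<Sum>t<n. ?P (?h t) s) =
        ?R s * (if h (c0, False) = h (c1, \<not> b) then 1 else 0)" .
  qed
  also have "\<dots> = (if h (c0, False) = h (c1, \<not> b) then COE_moment \<nu> (C - {c0, c1}) \<kappa> h else 0)"
    by (simp add: COE_moment_def)
  finally show ?thesis .
qed

text \<open>Each value in \<open>A\<close> occurs once among the plain and once among the conjugated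
  entries, so the general contraction applies to the slots \<open>(c1, b)\<close> and
  \<open>(c0, True)\<close>. Its exchange terms fall into three kinds: with a conjugated slot
  (zero), with the other slot of \<open>c0\<close> (the original moment), and with the remaining
  plain slots.\<close>

lemma COE_moment_contract:
  fixes \<kappa> :: "'c \<Rightarrow> bool"
  defines "C1 \<equiv> \<lambda>C. {c \<in> C. \<not> \<kappa> c} \<times> (UNIV :: bool set)"
    and "C2 \<equiv> \<lambda>C. {c \<in> C. \<kappa> c} \<times> (UNIV :: bool set)"
  assumes C: "finite C" and A: "A \<subseteq> {..<n}"
    and bij1: "bij_betw h (C1 C) A" and bij2: "bij_betw h (C2 C) A"
    and c: "c0 \<in> C" "c1 \<in> C" "\<not> \<kappa> c0" "\<kappa> c1"
    and eq: "h (c1, b) = h (c0, True)"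
  shows "(of_nat n + 1) * COE_moment \<nu> C \<kappa> h +
      (\<Sum>x\<in>A - {h (c0, False), h (c0, True)}.
        COE_moment \<nu> C \<kappa> (\<lambda>p. if \<kappa> (fst p) then h p else swap x (h (c0, True)) (h p))) =
    (if h (c0, False) = h (c1, \<not> b) then COE_moment \<nu> (C - {c0, c1}) \<kappa> h else 0)"
proof -
  define \<Phi> where "\<Phi> = (\<lambda>v. \<integral>s. (\<Prod>c\<in>C. form (\<kappa> c) s (v (c, False)) (v (c, True))) \<partial>\<nu>)"
  interpret F: invariant_form n "C \<times> UNIV" \<Phi>
    unfolding \<Phi>_def by (rule invariant_form[OF C])
  have component: "F.component f = COE_moment \<nu> C \<kappa> f" if "f ` (C \<times> UNIV) \<subseteq> {..<n}" for f
    using component_eq_COE_moment[OF C that] by (simp add: \<Phi>_def)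
  let ?P = "C \<times> (UNIV :: bool set)" and ?r = "(c1, b)" and ?s = "(c0, True)"
  have P: "?P = C1 C \<union> C2 C" "C1 C \<inter> C2 C = {}"
    by (auto simp: C1_def C2_def)
  have im: "h ` C1 C = A" "h ` C2 C = A" and inj: "inj_on h (C1 C)" "inj_on h (C2 C)"
    using bij1 bij2 by (auto simp: bij_betw_def)
  have h: "h ` ?P \<subseteq> {..<n}"
    using A im by (auto simp: P image_Un)
  have mem: "?s \<in> C1 C" "?r \<in> C2 C" "(c0, False) \<in> C1 C"
    using c by (auto simp: C1_def C2_def)
  have finP: "finite (C1 C)" "finite (C2 C)"
    using C by (auto simp: C1_def C2_def)
  have card_pairs: "card {y \<in> ?P. h y = h x} = 2" if "x \<in> ?P" for x
  proof -
    have "h x \<in> A" using that im by (auto simp: P)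
    then obtain u v where uv: "u \<in> C1 C" "h u = h x" "v \<in> C2 C" "h v = h x"
      using im by (metis imageE)
    have "y = u \<or> y = v" if "y \<in> ?P" "h y = h x" for y
      using that uv inj unfolding P by (metis Un_iff inj_onD)
    moreover have "u \<in> ?P" "v \<in> ?P"
      using uv P by blast+
    ultimately have "{y \<in> ?P. h y = h x} = {u, v}"
      using uv by blast
    moreover have "u \<noteq> v" using uv P by blast
    ultimately show ?thesis by simp
  qed
  have swap_h: "(h \<circ> swap x ?s) ` ?P \<subseteq> {..<n}" if "x \<in> ?P" for x
    using that h c by (auto simp: Transposition.transpose_def image_subset_iff)
  have "of_nat n * COE_moment \<nu> C \<kappa> h + (\<Sum>x\<in>?P - {?r, ?s}. COE_moment \<nu> C \<kappa> (h \<circ> swap x ?s)) =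
      of_nat n * F.component h + (\<Sum>x\<in>?P - {?r, ?s}. F.component (h \<circ> swap x ?s))"
    using h swap_h by (simp add: component)
  also have "\<dots> = (\<Sum>t<n. F.component (h(?r := t, ?s := t)))"
    by (rule F.sum_component_contract[symmetric]) (use C c eq h card_pairs in auto)
  also have "\<dots> = (\<Sum>t<n. COE_moment \<nu> C \<kappa> (h(?s := t, ?r := t)))"
  proof (intro sum.cong refl)
    fix t assume "t \<in> {..<n}"
    moreover have "h(?r := t, ?s := t) = h(?s := t, ?r := t)"
      by auto
    ultimately show "F.component (h(?r := t, ?s := t)) = COE_moment \<nu> C \<kappa> (h(?s := t, ?r := t))"
      using h by (subst component) auto
  qed
  also have "\<dots> = (if h (c0, False) = h (c1, \<not> b) then COE_moment \<nu> (C - {c0, c1}) \<kappa> h else 0)"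
    by (rule sum_COE_moment_update[OF C h c])
  also have "(\<Sum>x\<in>?P - {?r, ?s}. COE_moment \<nu> C \<kappa> (h \<circ> swap x ?s)) =
      (\<Sum>x\<in>C1 C - {?s}. COE_moment \<nu> C \<kappa> (h \<circ> swap x ?s)) +
      (\<Sum>x\<in>C2 C - {?r}. COE_moment \<nu> C \<kappa> (h \<circ> swap x ?s))"
  proof (subst sum.union_disjoint[symmetric])
    show "(\<Sum>x\<in>?P - {?r, ?s}. COE_moment \<nu> C \<kappa> (h \<circ> swap x ?s)) =
        (\<Sum>x\<in>C1 C - {?s} \<union> (C2 C - {?r}). COE_moment \<nu> C \<kappa> (h \<circ> swap x ?s))"
      using P mem by (intro sum.cong) auto
  qed (use finP P in auto)
  \<comment> \<open>After exchanging \<open>?s\<close> with a conjugated slot \<open>z\<close>, the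
    value \<open>h ?s\<close> sits at \<open>?r\<close> and \<open>z\<close> only, both conjugated,
    so the phase argument applies.\<close>
  also have "(\<Sum>x\<in>C2 C - {?r}. COE_moment \<nu> C \<kappa> (h \<circ> swap x ?s)) = 0"
  proof (intro sum.neutral ballI)
    fix z assume z: "z \<in> C2 C - {?r}"
    then have zs: "z \<in> ?P" "z \<noteq> ?s" "?r \<noteq> ?s" "h z \<noteq> h ?r"
      using P mem inj by (auto dest: inj_onD)
    show "COE_moment \<nu> C \<kappa> (h \<circ> swap z ?s) = 0"
    proof (rule COE_moment_eq_0[OF C swap_h[OF zs(1)], where y = ?r and z = z])
      fix x assume x: "x \<in> ?P" and hx: "(h \<circ> swap z ?s) x = h ?s"
      show "x = ?r \<or> x = z"
      proof (rule ccontr)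
        assume "\<not> (x = ?r \<or> x = z)"
        moreover from this have "x \<noteq> ?s"
          using hx eq zs by auto
        ultimately have "h x = h ?s" using hx by (simp add: Transposition.transpose_def)
        then have "x \<in> {y \<in> ?P. h y = h ?s}" using x by simp
        moreover have "{y \<in> ?P. h y = h ?s} = {?r, ?s}"
          using card_pairs[of ?s] c eq zs C
          by (intro card_subset_eq[symmetric]) auto
        ultimately show False
          using \<open>\<not> (x = ?r \<or> x = z)\<close> \<open>x \<noteq> ?s\<close> by auto
      qed
    qed (use z zs c eq in \<open>auto simp: C2_def Transposition.transpose_def\<close>)
  qed
  also have "(\<Sum>x\<in>C1 C - {?s}. COE_moment \<nu> C \<kappa> (h \<circ> swap x ?s)) =
      COE_moment \<nu> C \<kappa> h + (\<Sum>x\<in>C1 C - {(c0, False), ?s}. COE_moment \<nu> C \<kappa> (h \<circ> swap x ?s))"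
  proof -
    have "C1 C - {?s} - {(c0, False)} = C1 C - {(c0, False), ?s}" by auto
    then show ?thesis
      using finP mem COE_moment_flip[OF C c(1) h, of \<kappa>]
      by (subst sum.remove[of _ "(c0, False)"]) auto
  qed
  \<comment> \<open>As \<open>h\<close> is injective on the plain slots, exchanging two slots is the
    same as exchanging their values there. In this form the term matches an exchange of positions on
    the orthogonal side.\<close>
  also have "(\<Sum>x\<in>C1 C - {(c0, False), ?s}. COE_moment \<nu> C \<kappa> (h \<circ> swap x ?s)) =
      (\<Sum>x\<in>A - {h (c0, False), h (c0, True)}.
        COE_moment \<nu> C \<kappa> (\<lambda>p. if \<kappa> (fst p) then h p else swap x (h (c0, True)) (h p)))"
  proof -
    let ?g = "\<lambda>x. COE_moment \<nu> C \<kappa> (\<lambda>p. if \<kappa> (fst p) then h p else swap x (h (c0, True)) (h p))"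
    have "bij_betw h (C1 C - {(c0, False), ?s}) (h ` (C1 C - {(c0, False), ?s}))"
      using inj by (intro inj_on_imp_bij_betw) (auto intro: inj_on_subset)
    also have "h ` (C1 C - {(c0, False), ?s}) = A - {h (c0, False), h (c0, True)}"
      using im mem by (subst inj_on_image_set_diff[OF inj(1)]) auto
    finally have "sum ?g (A - {h (c0, False), h (c0, True)}) =
        (\<Sum>x\<in>C1 C - {(c0, False), ?s}. ?g (h x))"
      by (rule sum.reindex_bij_betw[symmetric])
    also have "\<dots> = (\<Sum>x\<in>C1 C - {(c0, False), ?s}. COE_moment \<nu> C \<kappa> (h \<circ> swap x ?s))"
    proof (rule sum.cong[OF refl])
      fix x assume x: "x \<in> C1 C - {(c0, False), ?s}"
      have "h (swap x ?s p) = (if \<kappa> (fst p) then h p else swap (h x) (h ?s) (h p))" if "p \<in> ?P" for p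
      proof (cases "\<kappa> (fst p)")
        case True
        then have "p \<noteq> x" "p \<noteq> ?s" using x c by (auto simp: C1_def)
        then show ?thesis using True by (simp add: Transposition.transpose_def)
      next
        case False
        then have "p \<in> C1 C" using that by (auto simp: C1_def)
        then have "h p = h x \<longleftrightarrow> p = x" "h p = h ?s \<longleftrightarrow> p = ?s"
          using inj x mem by (auto dest: inj_onD)
        then show ?thesis using False by (auto simp: Transposition.transpose_def)
      qed
      then show "?g (h x) = COE_moment \<nu> C \<kappa> (h \<circ> swap x ?s)"
        unfolding COE_moment_def by (intro Bochner_Integration.integral_cong prod.cong refl) simp
    qed
    finally show ?thesis ..
  qed
  finally show ?thesis
    by (simp add: algebra_simps)
qed

end

section \<open>Comparison of the moments\<close>

lemma bij_betw_swap:
  assumes "a \<in> A" "b \<in> A" shows "bij_betw (swap a b) A A"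
  using assms by (intro bij_betwI[where g = "swap a b"]) (auto simp: Transposition.transpose_def)

text \<open>The set \<open>A\<close> plays two roles: its elements are positions of the orthogonal
  product and index values of the circular one. Two positions share a row index iff they are the two
  indices of one plain entry, and share a column index iff they are those of one conjugated entry.
  Under this dictionary the two contractions are the same recursion.\<close>

lemma orthogonal_moment_eq_COE_moment:
  fixes \<kappa> :: "'c \<Rightarrow> bool" and h :: "'c \<times> bool \<Rightarrow> nat"
  assumes coe: "is_COE_measure d \<nu>" and haar: "is_Haar_orthogonal (d + 1) \<mu>"
    and C: "finite C" and A: "A \<subseteq> {..<d}"
    and bij1: "bij_betw h ({c \<in> C. \<not> \<kappa> c} \<times> UNIV) A"
    and bij2: "bij_betw h ({c \<in> C. \<kappa> c} \<times> UNIV) A"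
    and i: "i ` A \<subseteq> {..<d + 1}" and j: "j ` A \<subseteq> {..<d + 1}"
    and type_i: "\<And>p q. p \<in> {c \<in> C. \<not> \<kappa> c} \<times> UNIV \<Longrightarrow> q \<in> {c \<in> C. \<not> \<kappa> c} \<times> UNIV \<Longrightarrow>
      i (h p) = i (h q) \<longleftrightarrow> fst p = fst q"
    and type_j: "\<And>p q. p \<in> {c \<in> C. \<kappa> c} \<times> UNIV \<Longrightarrow> q \<in> {c \<in> C. \<kappa> c} \<times> UNIV \<Longrightarrow>
      j (h p) = j (h q) \<longleftrightarrow> fst p = fst q"
  shows "orthogonal_moment \<mu> A i j = COE_moment \<nu> C \<kappa> h"
  using C A bij1 bij2 i j type_i type_j
proof (induction "card C" arbitrary: C A h i rule: less_induct)
  case less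
  interpret S: coe d \<nu> by unfold_locales (rule coe)
  interpret U: haar_orthogonal "d + 1" \<mu> by unfold_locales (rule haar)
  define C1 where "C1 = {c \<in> C. \<not> \<kappa> c} \<times> (UNIV :: bool set)"
  define C2 where "C2 = {c \<in> C. \<kappa> c} \<times> (UNIV :: bool set)"
  note prems = less.prems[folded C1_def C2_def]
  have finA: "finite A"
    using prems(2) finite_subset by blast
  show ?case
  proof (cases "C1 = {}")
    case True
    then have "A = {}" "C2 = {}"
      using prems(3,4) by (auto simp: bij_betw_def)
    then have "C = {}"
      using True by (auto simp: C1_def C2_def)
    then show ?thesis
      using \<open>A = {}\<close> U.prob_space S.prob_space
      by (simp add: orthogonal_moment_def COE_moment_def)
  next
    case False
    then obtain c0 where c0: "c0 \<in> C" "\<not> \<kappa> c0" by (auto simp: C1_def)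
    \<comment> \<open>The supremum of the differences over all admissible data with fixed \<open>j\<close> and fixed indices
      of the conjugated entries is contracted by the recursion.\<close>
    define adm where "adm h' i' \<longleftrightarrow> bij_betw h' C1 A \<and> (\<forall>p\<in>C2. h' p = h p) \<and> i' ` A \<subseteq> {..<d + 1} \<and>
        (\<forall>p\<in>C1. \<forall>q\<in>C1. i' (h' p) = i' (h' q) \<longleftrightarrow> fst p = fst q)" for h' i'
    define e where "e h' i' = orthogonal_moment \<mu> A i' j - COE_moment \<nu> C \<kappa> h'" for h' i'
    define M where "M = (SUP (h', i')\<in>{(h', i'). adm h' i'}. norm (e h' i'))"
    have ran: "h' ` (C \<times> UNIV) \<subseteq> {..<d}" if "adm h' i'" for h' i'
    proof -
      have "h' ` C1 = A" using that by (simp add: adm_def bij_betw_def)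
      moreover have "h' ` C2 = h ` C2" using that by (intro image_cong) (auto simp: adm_def)
      moreover have "h ` C2 = A" using prems(4) by (simp add: bij_betw_def)
      moreover have "C \<times> UNIV = C1 \<union> C2" by (auto simp: C1_def C2_def)
      ultimately show ?thesis using prems(2) by (simp add: image_Un)
    qed
    have "norm (e h' i') \<le> 2" if "adm h' i'" for h' i'
    proof -
      have "norm (orthogonal_moment \<mu> A i' j) \<le> 1" "norm (COE_moment \<nu> C \<kappa> h') \<le> 1"
        using that ran[OF that] prems(6)
        by (auto simp: adm_def intro!: U.norm_orthogonal_moment_le S.norm_COE_moment_le)
      then show ?thesis
        unfolding e_def using norm_triangle_ineq4 by (smt (verit))
    qed
    then have bdd: "bdd_above ((\<lambda>(h', i'). norm (e h' i')) ` {(h', i'). adm h' i'})"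
      by (intro bdd_aboveI[where M = 2]) auto
    have upper: "norm (e h' i') \<le> M" if "adm h' i'" for h' i'
      unfolding M_def using that by (intro cSUP_upper2[OF bdd, where x = "(h', i')"]) auto
    have step: "real (d + 1) * norm (e h' i') \<le> real d * M" if adm: "adm h' i'" for h' i'
    proof -
      have bij1: "bij_betw h' C1 A" and h'_eq: "\<And>p. p \<in> C2 \<Longrightarrow> h' p = h p"
        and i': "i' ` A \<subseteq> {..<d + 1}"
        and type: "\<And>p q. p \<in> C1 \<Longrightarrow> q \<in> C1 \<Longrightarrow> i' (h' p) = i' (h' q) \<longleftrightarrow> fst p = fst q"
        using adm by (auto simp: adm_def)
      have bij2: "bij_betw h' C2 A"
        using prems(4) h'_eq by (simp cong: bij_betw_cong)
      have typej: "j (h' p) = j (h' q) \<longleftrightarrow> fst p = fst q" if "p \<in> C2" "q \<in> C2" for p q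
        using prems(8) that h'_eq by simp
      have im: "h' ` C1 = A" "h' ` C2 = A" and inj: "inj_on h' C1" "inj_on h' C2"
        using bij1 bij2 by (auto simp: bij_betw_def)
      define r s where "r = h' (c0, False)" and "s = h' (c0, True)"
      have c0': "(c0, b) \<in> C1" for b using c0 by (simp add: C1_def)
      have rs: "r \<in> A" "s \<in> A" "r \<noteq> s" "i' r = i' s"
        using c0' im inj(1) type by (auto simp: r_def s_def dest: inj_onD)
      obtain c1 b where c1: "(c1, b) \<in> C2" "h' (c1, b) = s"
        using rs(2) im(2) by (metis imageE surj_pair)
      then have c1': "c1 \<in> C" "\<kappa> c1" by (auto simp: C2_def)
      have c1'': "(c1, b') \<in> C2" for b' using c1' by (simp add: C2_def)
      \<comment> \<open>Both recursions reduce in the same case: the column indices at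
        \<open>r\<close> and \<open>s\<close> agree exactly when one conjugated entry carries both
        \<open>r\<close> and \<open>s\<close>.\<close>
      have j_iff: "j r = j s \<longleftrightarrow> r = h' (c1, \<not> b)"
      proof
        assume jrs: "j r = j s"
        obtain q where q: "q \<in> C2" "r = h' q" using rs(1) im(2) by blast
        then have "fst q = c1" using typej[OF q(1) c1(1)] jrs c1(2) by simp
        moreover have "q \<noteq> (c1, b)" using q(2) c1(2) rs(3) by auto
        ultimately have "q = (c1, \<not> b)" by (cases q) auto
        then show "r = h' (c1, \<not> b)" using q(2) by simp
      next
        assume "r = h' (c1, \<not> b)"
        then show "j r = j s" using typej[OF c1''[of "\<not> b"] c1(1)] c1(2) by simp
      qed
      have pairs: "card {y \<in> A. i' y = i' x} = 2" if x: "x \<in> A" for x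
      proof -
        obtain q where "q \<in> C1" "x = h' q"
          using x unfolding im(1)[symmetric] by blast
        then obtain c b' where cb: "(c, b') \<in> C1" "x = h' (c, b')"
          by (cases q) auto
        then have c: "(c, b) \<in> C1" for b by (simp add: C1_def)
        have "{y \<in> A. i' y = i' x} = h' ` {q \<in> C1. fst q = c}"
          using type[OF _ cb(1)] unfolding im(1)[symmetric] cb(2) by auto
        also have "{q \<in> C1. fst q = c} = {(c, False), (c, True)}"
          using c by (auto simp: C1_def)
        finally have "{y \<in> A. i' y = i' x} = {h' (c, False), h' (c, True)}"
          by simp
        moreover have "h' (c, False) \<noteq> h' (c, True)"
          using inj_onD[OF inj(1) _ c c, of False True] by auto
        ultimately show ?thesis
          by simp
      qed
      have orth: "of_nat (d + 1) * orthogonal_moment \<mu> A i' j +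
          (\<Sum>x\<in>A - {r, s}. orthogonal_moment \<mu> A (i' \<circ> swap x s) j) =
          (if j r = j s then orthogonal_moment \<mu> (A - {r, s}) i' j else 0)"
        by (rule U.orthogonal_moment_contract[OF finA i' prems(6) rs pairs])
      \<comment> \<open>Exchanging the values \<open>x\<close> and \<open>s\<close> in the plain
        entries is the counterpart of composing the row pattern with the same exchange.\<close>
      define h'' where "h'' x = (\<lambda>p. if \<kappa> (fst p) then h' p else swap x s (h' p))" for x
      have unit: "(of_nat d + 1) * COE_moment \<nu> C \<kappa> h' + (\<Sum>x\<in>A - {r, s}. COE_moment \<nu> C \<kappa> (h'' x)) =
          (if r = h' (c1, \<not> b) then COE_moment \<nu> (C - {c0, c1}) \<kappa> h' else 0)"
        unfolding h''_def
        by (rule S.COE_moment_contract[OF prems(1,2) bij1[unfolded C1_def] bij2[unfolded C2_def]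
            c0(1) c1'(1) c0(2) c1'(2), of b, folded r_def s_def, OF c1(2)])
      \<comment> \<open>Deleting the labels \<open>c0\<close> and \<open>c1\<close> removes exactly
        the values \<open>r\<close> and \<open>s\<close> from both bijections, so the data stay
        admissible for the induction.\<close>
      have lower: "orthogonal_moment \<mu> (A - {r, s}) i' j = COE_moment \<nu> (C - {c0, c1}) \<kappa> h'"
        if r: "r = h' (c1, \<not> b)"
      proof (rule less.hyps)
        show "card (C - {c0, c1}) < card C"
          using prems(1) c0(1) by (intro psubset_card_mono) auto
        have 1: "{c \<in> C - {c0, c1}. \<not> \<kappa> c} \<times> UNIV = C1 - {(c0, False), (c0, True)}"
          using c1' by (auto simp: C1_def)
        have 2: "{c \<in> C - {c0, c1}. \<kappa> c} \<times> UNIV = C2 - {(c1, b), (c1, \<not> b)}"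
          using c0 by (auto simp: C2_def)
        have "h' ` (C1 - {(c0, False), (c0, True)}) = A - {r, s}"
          using im c0' by (subst inj_on_image_set_diff[OF inj(1)]) (auto simp: r_def s_def)
        then show "bij_betw h' ({c \<in> C - {c0, c1}. \<not> \<kappa> c} \<times> UNIV) (A - {r, s})"
          unfolding 1 bij_betw_def using inj(1) by (auto intro: inj_on_subset)
        have "h' ` (C2 - {(c1, b), (c1, \<not> b)}) = A - {r, s}"
          using im c1'' c1(2) r by (subst inj_on_image_set_diff[OF inj(2)]) auto
        then show "bij_betw h' ({c \<in> C - {c0, c1}. \<kappa> c} \<times> UNIV) (A - {r, s})"
          unfolding 2 bij_betw_def using inj(2) by (auto intro: inj_on_subset)
        show "i' (h' p) = i' (h' q) \<longleftrightarrow> fst p = fst q"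
          if "p \<in> {c \<in> C - {c0, c1}. \<not> \<kappa> c} \<times> UNIV" "q \<in> {c \<in> C - {c0, c1}. \<not> \<kappa> c} \<times> UNIV" for p q
          using that type unfolding 1 by blast
        show "j (h' p) = j (h' q) \<longleftrightarrow> fst p = fst q"
          if "p \<in> {c \<in> C - {c0, c1}. \<kappa> c} \<times> UNIV" "q \<in> {c \<in> C - {c0, c1}. \<kappa> c} \<times> UNIV" for p q
          using that typej unfolding 2 by blast
      qed (use prems i' in auto)
      have adm'': "adm (h'' x) (i' \<circ> swap x s)" if "x \<in> A - {r, s}" for x
      proof -
        have swap: "bij_betw (swap x s) A A"
          using that rs(2) by (intro bij_betw_swap) auto
        have eq: "h'' x p = swap x s (h' p)" if "p \<in> C1" for p
          using that by (auto simp: h''_def C1_def)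
        have "bij_betw (h'' x) C1 A"
          using bij_betw_trans[OF bij1 swap] eq by (simp cong: bij_betw_cong)
        moreover have "h'' x p = h p" if "p \<in> C2" for p
          using that h'_eq by (auto simp: h''_def C2_def)
        moreover have "(i' \<circ> swap x s) ` A \<subseteq> {..<d + 1}"
          using i' bij_betw_imp_surj_on[OF swap] unfolding image_comp[symmetric] by simp
        ultimately show ?thesis
          using type by (simp add: adm_def eq)
      qed
      \<comment> \<open>Subtracting the recursions cancels the reduced moments and leaves a
        homogeneous relation between the differences.\<close>
      have "of_nat (d + 1) * e h' i' + (\<Sum>x\<in>A - {r, s}. e (h'' x) (i' \<circ> swap x s)) =
          (of_nat (d + 1) * orthogonal_moment \<mu> A i' j +
            (\<Sum>x\<in>A - {r, s}. orthogonal_moment \<mu> A (i' \<circ> swap x s) j)) -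
          ((of_nat d + 1) * COE_moment \<nu> C \<kappa> h' + (\<Sum>x\<in>A - {r, s}. COE_moment \<nu> C \<kappa> (h'' x)))"
        by (simp add: e_def sum_subtractf algebra_simps)
      also have "\<dots> = 0"
        unfolding orth unit using lower by (simp add: j_iff)
      finally have "of_nat (d + 1) * e h' i' = - (\<Sum>x\<in>A - {r, s}. e (h'' x) (i' \<circ> swap x s))"
        by (simp only: eq_neg_iff_add_eq_0)
      then have "real (d + 1) * norm (e h' i') = norm (\<Sum>x\<in>A - {r, s}. e (h'' x) (i' \<circ> swap x s))"
        by (metis norm_minus_cancel norm_mult norm_of_nat)
      also have "\<dots> \<le> (\<Sum>x\<in>A - {r, s}. M)"
        by (intro sum_norm_le upper adm'')
      also have "\<dots> = real (card (A - {r, s})) * M"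
        by simp
      \<comment> \<open>The crude bound \<open>d\<close> on the number of exchange terms is already
        strictly below the diagonal coefficient \<open>d + 1\<close>.\<close>
      also have "\<dots> \<le> real d * M"
      proof (intro mult_right_mono)
        have "card (A - {r, s}) \<le> card {..<d}"
          using prems(2) by (intro card_mono) auto
        then show "real (card (A - {r, s})) \<le> real d" by simp
        show "0 \<le> M"
          using order_trans[OF norm_ge_zero upper[OF adm]] .
      qed
      finally show ?thesis .
    qed
    have adm: "adm h i"
      using prems by (simp add: adm_def)
    \<comment> \<open>Taking the supremum in \<open>step\<close> bounds \<open>M\<close> by a
      multiple of itself with factor below 1, which forces \<open>M \<le> 0\<close>.\<close>
    have "M \<le> real d * M / real (d + 1)"
      unfolding M_def
    proof (rule cSUP_least, goal_cases)
      case (2 x)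
      then show ?case
        using step[of "fst x" "snd x"] unfolding M_def[symmetric] by (auto simp: field_simps)
    qed (use adm in auto)
    then have "M \<le> 0"
      by (simp add: field_simps)
    then have "norm (e h i) \<le> 0"
      using upper[OF adm] by (rule order_trans[rotated])
    then show ?thesis
      by (simp add: e_def)
  qed
qed

section \<open>Pair partitions and their index patterns\<close>

lemma pair_partition_block:
  assumes "pair_partition k m" "B \<in> m"
  shows "finite B" "B = {Min B, Max B}" "Min B < Max B" "B \<subseteq> {1..2*k}"
proof -
  show fin: "finite B" using assms by (intro card_ge_0_finite) (auto simp: pair_partition_def)
  obtain x y where xy: "B = {x, y}" "x \<noteq> y"
    using assms by (auto simp: pair_partition_def card_2_iff)
  then show "B = {Min B, Max B}" "Min B < Max B" by (auto simp: min_def max_def)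
  show "B \<subseteq> {1..2*k}"
    using assms by (auto simp: pair_partition_def partition_on_def)
qed

lemma pair_partition_eq:
  assumes "pair_partition k m" "B \<in> m" "B' \<in> m" "x \<in> B" "x \<in> B'" shows "B = B'"
  using assms by (auto simp: pair_partition_def partition_on_def disjoint_def)

lemma finite_pair_partition: "pair_partition k m \<Longrightarrow> finite m"
  by (auto simp: pair_partition_def intro: finite_elements)

text \<open>The flag agrees with the slot flag of \<open>COE_moment\<close>: \<open>False\<close>
  gives the row index, here the smaller element.\<close>

definition block_elem :: "nat set \<Rightarrow> bool \<Rightarrow> nat" where
  "block_elem B b = (if b then Max B else Min B)"

lemma block_elem_mem: "pair_partition k m \<Longrightarrow> B \<in> m \<Longrightarrow> block_elem B b \<in> B"
  using pair_partition_block(2)[of k m B] by (auto simp: block_elem_def)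

lemma bij_betw_block_elem:
  assumes m: "pair_partition k m"
  shows "bij_betw (\<lambda>p. block_elem (fst p) (snd p) - 1) (m \<times> UNIV) {..<2*k}"
proof -
  have "inj_on (\<lambda>p. block_elem (fst p) (snd p)) (m \<times> UNIV)"
  proof (rule inj_onI, clarsimp)
    fix B B' b b' assume B: "B \<in> m" "B' \<in> m" and eq: "block_elem B b = block_elem B' b'"
    then have "B = B'"
      using pair_partition_eq[OF m B] block_elem_mem[OF m] by metis
    then show "B = B' \<and> b = b'"
      using eq pair_partition_block(3)[OF m B(1)] by (auto simp: block_elem_def split: if_splits)
  qed
  moreover have "(\<lambda>p. block_elem (fst p) (snd p)) ` (m \<times> UNIV) = {1..2*k}"
  proof -
    have "(\<lambda>p. block_elem (fst p) (snd p)) ` (m \<times> UNIV) = (\<Union>B\<in>m. block_elem B ` UNIV)"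
      by force
    also have "\<dots> = (\<Union>B\<in>m. {Min B, Max B})"
      by (simp add: block_elem_def UNIV_bool insert_commute)
    also have "\<dots> = \<Union>m"
      using pair_partition_block(2)[OF m] by auto
    finally show ?thesis
      using m by (auto simp: pair_partition_def partition_on_def)
  qed
  ultimately have "bij_betw (\<lambda>p. block_elem (fst p) (snd p)) (m \<times> UNIV) {1..2*k}"
    by (simp add: bij_betw_def)
  moreover have "bij_betw (\<lambda>x. x - 1) {1..2*k} {..<2*k}"
    by (intro bij_betwI[where g = Suc]) auto
  ultimately show ?thesis
    by (drule_tac bij_betw_trans) (auto simp: o_def)
qed

text \<open>\<open>index_of_type\<close> constrains only distinct positions, so equal ones are
  handled separately.\<close>

lemma index_of_type_block_elem:
  assumes m: "pair_partition k m" and f: "index_of_type k D m f" and B: "B \<in> m" "B' \<in> m"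
  shows "f (block_elem B b) = f (block_elem B' b') \<longleftrightarrow> B = B'"
proof (cases "block_elem B b = block_elem B' b'")
  case True
  then show ?thesis
    using pair_partition_eq[OF m B] block_elem_mem[OF m] B by metis
next
  case False
  have mem: "block_elem B b \<in> B" "block_elem B' b' \<in> B'"
    using block_elem_mem[OF m] B by auto
  moreover have "block_elem B b \<in> {1..2*k}" "block_elem B' b' \<in> {1..2*k}"
    using mem pair_partition_block(4)[OF m] B by blast+
  ultimately have "f (block_elem B b) = f (block_elem B' b') \<longleftrightarrow> {block_elem B b, block_elem B' b'} \<in> m"
    using f False by (simp add: index_of_type_def)
  also have "\<dots> \<longleftrightarrow> B = B'"
  proof
    assume "{block_elem B b, block_elem B' b'} \<in> m"
    then show "B = B'"
      using pair_partition_eq[OF m] B mem by (metis insertI1 insertI2 singletonI)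
  next
    assume eq: "B = B'"
    then have "{block_elem B b, block_elem B' b'} = B"
      using False pair_partition_block(2)[OF m B(1)]
      by (cases b; cases b') (auto simp: block_elem_def)
    then show "{block_elem B b, block_elem B' b'} \<in> m" using B by simp
  qed
  finally show ?thesis .
qed

lemma standard_pairing_pair_partition: "pair_partition k (standard_pairing k)"
proof -
  have "\<Union> (standard_pairing k) = {1..2*k}"
  proof (intro equalityI subsetI)
    fix x assume x: "x \<in> {1..2*k}"
    then have "(x + 1) div 2 \<in> {1..k}" "x \<in> {2 * ((x + 1) div 2) - 1, 2 * ((x + 1) div 2)}"
      by auto
    then show "x \<in> \<Union> (standard_pairing k)"
      unfolding standard_pairing_def by blast
  qed (auto simp: standard_pairing_def)
  moreover have "disjoint (standard_pairing k)"
    unfolding standard_pairing_def disjoint_def by auto presburger+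
  moreover have "card {2 * j - 1, 2 * j} = 2" if "j \<ge> 1" for j :: nat
    using that by auto
  ultimately show ?thesis
    unfolding pair_partition_def partition_on_def by (auto simp: standard_pairing_def)
qed

text \<open>Indexes the plain factors by blocks, just like the conjugated ones.\<close>

lemma prod_standard_pairing:
  "(\<Prod>B\<in>standard_pairing k. f (Min B) (Max B)) = (\<Prod>j=1..k. f (2 * j - 1) (2 * j))"
proof -
  have Max: "Max {2 * j - 1, 2 * j} = 2 * j" and Min: "Min {2 * j - 1, 2 * j} = 2 * j - 1" for j :: nat
    by auto
  have "inj_on (\<lambda>j::nat. {2 * j - 1, 2 * j}) {1..k}"
    by (rule inj_on_inverseI[where g = "\<lambda>B. Max B div 2"]) (subst Max, simp)
  then show ?thesis
    unfolding standard_pairing_def by (simp only: prod.reindex o_def Max Min)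
qed

theorem theorem5p4:
  fixes d k :: nat and m :: "nat set set"
    and \<nu> :: "complex mat measure" and \<mu> :: "real mat measure"
    and i j :: "nat \<Rightarrow> nat"
  assumes "d \<ge> 2 * k"
    and "pair_partition k m"
    and "is_COE_measure d \<nu>"
    and "is_Haar_orthogonal (d + 1) \<mu>"
    and "index_of_type k (d + 1) (standard_pairing k) i"
    and "index_of_type k (d + 1) m j"
  shows "Wg_COE \<nu> k m = complex_of_real (Wg_O \<mu> k i j)"
proof -
  \<comment> \<open>The tag marks conjugated entries and keeps the two pairings apart even when they
    share a block.\<close>
  define C where "C = standard_pairing k \<times> {False} \<union> m \<times> {True}"
  define h where "h p = block_elem (fst (fst p)) (snd p) - 1" for p :: "(nat set \<times> bool) \<times> bool"
  let ?f = "\<lambda>f x. f (x + 1) - 1 :: nat"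
  have std: "pair_partition k (standard_pairing k)"
    by (rule standard_pairing_pair_partition)
  have bij: "bij_betw h ((p \<times> {b}) \<times> UNIV) {..<2*k}" if "pair_partition k p" for p b
  proof -
    have "bij_betw (\<lambda>q. (fst (fst q), snd q)) ((p \<times> {b}) \<times> (UNIV :: bool set)) (p \<times> UNIV)"
      by (intro bij_betwI[where g = "\<lambda>q. ((fst q, b), snd q)"]) auto
    from bij_betw_trans[OF this bij_betw_block_elem[OF that]] show ?thesis
      by (simp add: o_def h_def[abs_def])
  qed
  have type: "?f f (h q) = ?f f (h q') \<longleftrightarrow> fst q = fst q'"
    if p: "pair_partition k p" and f: "index_of_type k (d + 1) p f"
      and q: "q \<in> (p \<times> {b}) \<times> UNIV" "q' \<in> (p \<times> {b}) \<times> UNIV" for p f b q q'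
  proof -
    have B: "fst (fst q) \<in> p" "fst (fst q') \<in> p" using q by auto
    have pos: "block_elem B b \<in> {1..2*k}" if "B \<in> p" for B b
      using block_elem_mem[OF p that] pair_partition_block(4)[OF p that] by blast
    then have "h q + 1 = block_elem (fst (fst q)) (snd q)" "h q' + 1 = block_elem (fst (fst q')) (snd q')"
      using pos[OF B(1), of "snd q"] pos[OF B(2), of "snd q'"] by (simp_all add: h_def)
    \<comment> \<open>Truncated subtraction of 1 is injective only on positive values.\<close>
    moreover have "f x \<ge> 1" if "x \<in> {1..2*k}" for x
      using f that by (auto simp: index_of_type_def)
    ultimately have "?f f (h q) = ?f f (h q') \<longleftrightarrow>
        f (block_elem (fst (fst q)) (snd q)) = f (block_elem (fst (fst q')) (snd q'))"
      using pos B by (metis le_add_diff_inverse2)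
    also have "\<dots> \<longleftrightarrow> fst (fst q) = fst (fst q')"
      by (rule index_of_type_block_elem[OF p f B])
    also have "\<dots> \<longleftrightarrow> fst q = fst q'"
      using q by (auto simp: prod_eq_iff)
    finally show ?thesis .
  qed
  have range: "?f f ` {..<2*k} \<subseteq> {..<d + 1}" if "index_of_type k (d + 1) p f" for f p
  proof (rule image_subsetI)
    fix x assume "x \<in> {..<2*k}"
    then have "f (x + 1) \<in> {1..d + 1}"
      using that by (auto simp: index_of_type_def)
    then show "f (x + 1) - 1 \<in> {..<d + 1}" by auto
  qed
  have C12: "{c \<in> C. \<not> snd c} = standard_pairing k \<times> {False}" "{c \<in> C. snd c} = m \<times> {True}"
    by (auto simp: C_def)
  have "complex_of_real (Wg_O \<mu> k i j) = orthogonal_moment \<mu> {..<2*k} (?f i) (?f j)"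
  proof -
    have "(\<Prod>r=1..2*k. entry u (i r) (j r)) = (\<Prod>x<2*k. u $$ (?f i x, ?f j x))" for u :: "real mat"
      by (intro prod.reindex_bij_witness[where i = Suc and j = "\<lambda>x. x - 1"]) (auto simp: entry_def)
    then show ?thesis
      by (simp add: Wg_O_def orthogonal_moment_def flip: of_real_prod)
  qed
  also have "\<dots> = COE_moment \<nu> C snd h"
  proof (rule orthogonal_moment_eq_COE_moment[OF assms(3,4)])
    show "finite C"
      using finite_pair_partition assms(2) std by (auto simp: C_def)
    \<comment> \<open>The bound on \<open>d\<close> lets all 2k positions serve as indices of a
      matrix of size \<open>d\<close>.\<close>
    show "{..<2*k} \<subseteq> {..<d}" using assms(1) by auto
  qed (use bij type range std assms in \<open>simp_all only: C12\<close>)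
  also have "\<dots> = Wg_COE \<nu> k m"
    unfolding Wg_COE_def COE_moment_def
  proof (intro Bochner_Integration.integral_cong refl)
    fix s :: "complex mat"
    have "(\<Prod>c\<in>C. cnj_if (snd c) (s $$ (h (c, False), h (c, True)))) =
        (\<Prod>c\<in>standard_pairing k \<times> {False}. cnj_if (snd c) (s $$ (h (c, False), h (c, True)))) *
        (\<Prod>c\<in>m \<times> {True}. cnj_if (snd c) (s $$ (h (c, False), h (c, True))))"
      unfolding C_def using finite_pair_partition assms(2) std
      by (intro prod.union_disjoint) auto
    also have "(\<Prod>c\<in>standard_pairing k \<times> {False}. cnj_if (snd c) (s $$ (h (c, False), h (c, True)))) =
        (\<Prod>B\<in>standard_pairing k. entry s (Min B) (Max B))"
      by (intro prod.reindex_bij_witness[where i = "\<lambda>B. (B, False)" and j = fst])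
        (auto simp: h_def entry_def cnj_if_def block_elem_def)
    also have "\<dots> = (\<Prod>j=1..k. entry s (2 * j - 1) (2 * j))"
      by (rule prod_standard_pairing)
    also have "(\<Prod>c\<in>m \<times> {True}. cnj_if (snd c) (s $$ (h (c, False), h (c, True)))) =
        (\<Prod>B\<in>m. cnj (entry s (Min B) (Max B)))"
      by (intro prod.reindex_bij_witness[where i = "\<lambda>B. (B, True)" and j = fst])
        (auto simp: h_def entry_def cnj_if_def block_elem_def)
    finally show "(\<Prod>c\<in>C. cnj_if (snd c) (s $$ (h (c, False), h (c, True)))) =
        (\<Prod>j=1..k. entry s (2 * j - 1) (2 * j)) * cnj (\<Prod>B\<in>m. entry s (Min B) (Max B))"
      by simp
  qed
  finally show ?thesis ..
qed

end
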